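(* Let $G$ be a compact, connected topological group with normalized Haar measure $\mu$. Let $\lambda$ be a Borel probability measure on $G$ and let $\kappa\le 1$ satisfy $\kappa\geq2\rho^{+}(\lambda)>0$. Let $$\lambda=\kappa\lambda_{1}+(1-\kappa)\lambda_{2}$$ where $\lambda_{1},\lambda_2$ are Borel probability measures on $G$. Then $G$ is $\lambda_{1}$-ergodic and we have $$\rho^{+}(\lambda_{1})<1-\frac{1}{512}\left(\frac{\rho^{+}(\lambda)}{\log_{2}(2/\rho^{+}(\lambda))}\right)^{2}.$$
   Context: $G$ acts on itself by left translation, preserving $\mu$. For a Borel probability measure $\lambda$ on $G$, let $M_\lambda$ be the averaging operator $(fM_\lambda)(x)=\int_G f(ax)\,d\lambda(a)$ on the real space $L^2(G,\mu)$, let $L_0^2(G)$ be the subspace of functions with zero integral, and let $$\rho^+(\lambda)=\sup_{0\ne f\in L_0^2(G)}\frac{\langle fM_\lambda,f\rangle}{\langle f,f\rangle}.$$ $G$ is $\lambda_1$-ergodic if every Borel subset $Y\subseteq G$ with $\int_G\mu(aY\setminus Y)\,d\lambda_1(a)=0$ satisfies $\mu(Y)\in\{0,1\}$. The measures are not assumed to be symmetric. *)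

theory Defs
  imports "HOL-Probability.Probability"
begin

text \<open>
  Groups are written additively, as in the library class \<open>topological_group_add\<close>, which does not
  assume commutativity: \<open>a + x\<close> is the product \<open>ax\<close>, and \<open>(+) a ` Y\<close> is the translate \<open>aY\<close>.
\<close>

definition borel_prob :: "'a::topological_space measure \<Rightarrow> bool" where
  "borel_prob M \<longleftrightarrow> prob_space M \<and> sets M = sets borel"

text \<open>
  Regularity is part of the notion of Haar measure. It has to be required explicitly because
  the group need not be metrizable.
\<close>

definition normalized_haar :: "'a::{topological_group_add, t2_space} measure \<Rightarrow> bool" where
  "normalized_haar \<mu> \<longleftrightarrow>
     borel_prob \<mu> \<and>
     (\<forall>a. \<forall>A\<in>sets borel. emeasure \<mu> ((+) a ` A) = emeasure \<mu> A) \<and>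
     (\<forall>A\<in>sets borel. emeasure \<mu> A = (INF U\<in>{U. open U \<and> A \<subseteq> U}. emeasure \<mu> U)) \<and>
     (\<forall>U. open U \<longrightarrow> emeasure \<mu> U = (SUP K\<in>{K. compact K \<and> K \<subseteq> U}. emeasure \<mu> K))"

definition L2 :: "'a measure \<Rightarrow> ('a \<Rightarrow> real) set" where
  "L2 \<mu> = {f \<in> borel_measurable \<mu>. integrable \<mu> (\<lambda>x. (f x)\<^sup>2)}"

definition L2_0 :: "'a measure \<Rightarrow> ('a \<Rightarrow> real) set" where
  "L2_0 \<mu> = {f \<in> L2 \<mu>. (\<integral>x. f x \<partial>\<mu>) = 0}"

text \<open>
  The completion is used because, on a non-metrizable group and for a Borel probability measure
  \<open>\<nu>\<close> that is not regular, the function \<open>averaging \<nu> f\<close> below is in general only almost everywhere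
  equal to a Borel function, and the Bochner integral of a non-measurable function is 0 by
  convention. On Borel functions the completion makes no difference.
\<close>

definition L2_inner :: "'a measure \<Rightarrow> ('a \<Rightarrow> real) \<Rightarrow> ('a \<Rightarrow> real) \<Rightarrow> real" where
  "L2_inner \<mu> f g = (\<integral>x. f x * g x \<partial>completion \<mu>)"

definition averaging :: "'a::plus measure \<Rightarrow> ('a \<Rightarrow> real) \<Rightarrow> 'a \<Rightarrow> real" where
  "averaging \<nu> f x = (\<integral>a. f (a + x) \<partial>\<nu>)"

text \<open>
  Elements of \<open>L2_0 \<mu>\<close> are functions rather than classes, so nonzero means not almost everywhere
  zero. For the Haar measure the set below is bounded above by 1, and it is empty only if the
  group is trivial.
\<close>

definition rho_plus :: "'a::plus measure \<Rightarrow> 'a measure \<Rightarrow> real" where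
  "rho_plus \<mu> \<nu> =
     (SUP f\<in>{f \<in> L2_0 \<mu>. \<not> (AE x in \<mu>. f x = 0)}.
        L2_inner \<mu> (averaging \<nu> f) f / L2_inner \<mu> f f)"

definition ergodic :: "'a::{topological_space, plus} measure \<Rightarrow> 'a measure \<Rightarrow> bool" where
  "ergodic \<mu> \<nu> \<longleftrightarrow>
     (\<forall>Y\<in>sets borel. (\<integral>\<^sup>+a. emeasure \<mu> ((+) a ` Y - Y) \<partial>\<nu>) = 0 \<longrightarrow> measure \<mu> Y \<in> {0, 1})"

end

theory Submission
  imports Defs
begin

text \<open>
  Write \<open>\<rho>\<close> for the number \<open>rho_plus \<mu> \<nu>\<close>. If \<open>rho_plus \<mu> \<nu>1\<close> is close to 1, a Cheeger argument
  applied to the level sets of an almost invariant function (shifted by its median) gives a set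
  \<open>Y\<close> with \<open>0 < \<mu> Y \<le> 1/2\<close> that \<open>\<nu>1\<close> moves very little; failure of ergodicity gives one that it
  does not move at all. Right translates of \<open>Y\<close> are moved just as little, since \<open>\<mu>\<close> is
  bi-invariant, and as the group is connected, \<open>\<mu> (Z \<inter> Yg)\<close> takes its mean value \<open>\<mu> Z * \<mu> Y\<close> for
  some \<open>g\<close>. Intersecting about \<open>log 2 (2 / \<rho>)\<close> translates yields a set \<open>Z\<close> of measure at most
  \<open>\<rho> / 2\<close> that is still moved little by \<open>\<nu>1\<close>. As \<open>\<nu> \<ge> 2 * \<rho> * \<nu>1\<close>, the indicator function of such
  a small \<open>Z\<close>, minus its mean, has Rayleigh quotient greater than \<open>\<rho>\<close> for \<open>\<nu>\<close>, a contradiction.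

  Without a countable base, addition need not be measurable from the product of the Borel sigma
  algebras to the Borel sigma algebra, but it is measurable to the Baire sigma algebra. Fubini's
  theorem is therefore only applied to Baire functions, and completion regularity of Haar measure
  replaces each Borel function by a Baire function that agrees with it outside a Baire null set.
\<close>

subsection \<open>A Cheeger inequality for pairs of equidistributed variables\<close>

context prob_space begin

text \<open>Integrating \<open>levels\<close> at level \<open>sqrt t\<close> over all
  \<open>t > 0\<close> bounds \<open>s * N\<close> by the integral of the positive part of
  \<open>F\<^sup>2 - H\<^sup>2\<close>. As the two squares have equal integrals, twice that integral
  is the integral of \<open>\<bar>F - H\<bar> * (F + H)\<close>, which AM-GM compares with the
  integral of \<open>(F - H)\<^sup>2\<close>.\<close>

lemma level_sets_imp_L2_gap:
  fixes F H :: "'a \<Rightarrow> real"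
  assumes [measurable]: "F \<in> borel_measurable M" "H \<in> borel_measurable M"
    and nonneg: "\<And>x. 0 \<le> F x" "\<And>x. 0 \<le> H x"
    and F2: "integrable M (\<lambda>x. (F x)\<^sup>2)" and H2: "integrable M (\<lambda>x. (H x)\<^sup>2)"
    and eq: "(\<integral>x. (F x)\<^sup>2 \<partial>M) = (\<integral>x. (H x)\<^sup>2 \<partial>M)"
    and s: "0 \<le> s"
    and levels: "\<And>t. 0 \<le> t \<Longrightarrow> s * prob {x\<in>space M. t < H x} \<le> prob {x\<in>space M. t < F x \<and> H x \<le> t}"
  shows "s\<^sup>2 * (\<integral>x. (H x)\<^sup>2 \<partial>M) \<le> (\<integral>x. (F x - H x)\<^sup>2 \<partial>M)"
proof -
  define N where "N = (\<integral>x. (H x)\<^sup>2 \<partial>M)"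
  define D where "D = (\<integral>x. (F x - H x)\<^sup>2 \<partial>M)"
  have N0: "0 \<le> N" by (simp add: N_def)
  have FH: "integrable M (\<lambda>x. F x * H x)"
  proof (rule Bochner_Integration.integrable_bound[of _ "\<lambda>x. (F x)\<^sup>2 + (H x)\<^sup>2"])
    show "AE x in M. norm (F x * H x) \<le> norm ((F x)\<^sup>2 + (H x)\<^sup>2)"
    proof (rule AE_I2)
      fix x
      have "2 * (F x * H x) \<le> (F x)\<^sup>2 + (H x)\<^sup>2" using sum_squares_bound[of "F x" "H x"] by simp
      moreover have "0 \<le> F x * H x" using nonneg by simp
      ultimately show "norm (F x * H x) \<le> norm ((F x)\<^sup>2 + (H x)\<^sup>2)" by simp
    qed
  qed (use F2 H2 in auto)
  have d2: "integrable M (\<lambda>x. (F x - H x)\<^sup>2)" and s2: "integrable M (\<lambda>x. (F x + H x)\<^sup>2)"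
    using F2 H2 FH by (auto simp: power2_diff power2_sum mult.assoc)
  have sumle: "(\<integral>x. (F x + H x)\<^sup>2 \<partial>M) \<le> 4 * N"
  proof -
    have "(\<integral>x. (F x + H x)\<^sup>2 \<partial>M) \<le> (\<integral>x. 2 * (F x)\<^sup>2 + 2 * (H x)\<^sup>2 \<partial>M)"
    proof (rule integral_mono)
      show "(F x + H x)\<^sup>2 \<le> 2 * (F x)\<^sup>2 + 2 * (H x)\<^sup>2" for x
        using sum_squares_bound[of "F x" "H x"] by (simp add: power2_sum)
    qed (use s2 F2 H2 in auto)
    also have "\<dots> = 4 * N" using F2 H2 eq by (simp add: N_def)
    finally show ?thesis .
  qed
  show ?thesis
  proof (cases "s = 0")
    case True
    then show ?thesis by simp
  next
    case False
    with s have s_pos: "0 < s" by simp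
    define G where "G x = max 0 ((F x)\<^sup>2 - (H x)\<^sup>2)" for x
    have G_nonneg: "0 \<le> G x" for x by (simp add: G_def)
    have Gint: "integrable M G" unfolding G_def
      using F2 H2 by (intro integrable_max) auto
    have "(\<integral>x. 2 * G x - ((F x)\<^sup>2 - (H x)\<^sup>2) \<partial>M) \<le> (\<integral>x. (F x - H x)\<^sup>2 / s + s / 4 * (F x + H x)\<^sup>2 \<partial>M)"
    proof (rule integral_mono)
      fix x
      have "2 * G x - ((F x)\<^sup>2 - (H x)\<^sup>2) = \<bar>(F x)\<^sup>2 - (H x)\<^sup>2\<bar>"
        by (auto simp: G_def max_def)
      also have "\<dots> = \<bar>F x - H x\<bar> * (F x + H x)"
        using nonneg[of x] by (simp add: power2_eq_square square_diff_square_factored abs_mult mult.commute)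
      also have "\<dots> \<le> (F x - H x)\<^sup>2 / s + s / 4 * (F x + H x)\<^sup>2"
      proof -
        \<comment> \<open>The weight is chosen so that, by \<open>sumle\<close>, the second term
          integrates to at most \<open>s * N\<close>. That absorbs half of the lower bound
          \<open>2 * s * N\<close> and leaves \<open>s * N \<le> D / s\<close>.\<close>
        have "0 \<le> (\<bar>F x - H x\<bar> - s / 2 * (F x + H x))\<^sup>2" by simp
        then show ?thesis using s_pos by (simp add: field_simps power2_eq_square)
      qed
      finally show "2 * G x - ((F x)\<^sup>2 - (H x)\<^sup>2) \<le> (F x - H x)\<^sup>2 / s + s / 4 * (F x + H x)\<^sup>2" .
    qed (use Gint F2 H2 d2 s2 in auto)
    also have "\<dots> = D / s + s / 4 * (\<integral>x. (F x + H x)\<^sup>2 \<partial>M)"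
      using d2 s2 by (simp add: D_def)
    also have "\<dots> \<le> D / s + s / 4 * (4 * N)"
      using sumle s by (intro add_left_mono mult_left_mono) auto
    finally have G_le: "2 * (\<integral>x. G x \<partial>M) \<le> D / s + s * N"
      using Gint F2 H2 eq by simp
    \<comment> \<open>Layer-cake formula. It also holds for negative \<open>u\<close>, where
      \<open>ennreal\<close> truncates to 0 and the interval is empty.\<close>
    have layer: "ennreal u = (\<integral>\<^sup>+t. indicator {0<..} t * indicator {..<u} t \<partial>lborel)" for u :: real
    proof -
      have "(\<integral>\<^sup>+t. indicator {0<..} t * indicator {..<u} t \<partial>lborel) = (\<integral>\<^sup>+t. indicator {0<..<u} t \<partial>lborel)"
        by (intro nn_integral_cong) (auto simp: indicator_def)
      also have "\<dots> = emeasure lborel {0<..<u}" by simp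
      also have "\<dots> = ennreal u" by (cases "0 \<le> u") (auto simp: ennreal_neg)
      finally show ?thesis by simp
    qed
    interpret L: pair_sigma_finite M lborel ..
    have "ennreal (s * N) = ennreal s * (\<integral>\<^sup>+x. (H x)\<^sup>2 \<partial>M)"
      using H2 s N0 by (simp add: nn_integral_eq_integral N_def ennreal_mult)
    also have "(\<integral>\<^sup>+x. (H x)\<^sup>2 \<partial>M) = (\<integral>\<^sup>+x. \<integral>\<^sup>+t. indicator {0<..} t * indicator {t. t < (H x)\<^sup>2} t \<partial>lborel \<partial>M)"
      by (subst layer) (simp add: lessThan_def)
    also have "\<dots> = (\<integral>\<^sup>+t. \<integral>\<^sup>+x. indicator {0<..} t * indicator {t. t < (H x)\<^sup>2} t \<partial>M \<partial>lborel)"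
      by (rule L.Fubini'[symmetric]) simp
    also have "\<dots> = (\<integral>\<^sup>+t. indicator {0<..} t * prob {x\<in>space M. t < (H x)\<^sup>2} \<partial>lborel)"
      by (intro nn_integral_cong)
         (auto simp: indicator_def emeasure_eq_measure[symmetric] simp flip: nn_integral_indicator intro!: nn_integral_cong)
    also have "ennreal s * \<dots> = (\<integral>\<^sup>+t. ennreal s * (indicator {0<..} t * prob {x\<in>space M. t < (H x)\<^sup>2}) \<partial>lborel)"
      by (subst nn_integral_cmult) (auto)
    also have "\<dots> \<le> (\<integral>\<^sup>+t. indicator {0<..} t * prob {x\<in>space M. t < (F x)\<^sup>2 \<and> (H x)\<^sup>2 \<le> t} \<partial>lborel)"
    proof (intro nn_integral_mono)
      fix t :: real
      have "s * prob {x\<in>space M. t < (H x)\<^sup>2} \<le> prob {x\<in>space M. t < (F x)\<^sup>2 \<and> (H x)\<^sup>2 \<le> t}" if "t > 0"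
      proof -
        have "t < (H x)\<^sup>2 \<longleftrightarrow> sqrt t < H x" "t < (F x)\<^sup>2 \<longleftrightarrow> sqrt t < F x" for x
          using that nonneg[of x] by (metis less_eq_real_def real_less_rsqrt real_sqrt_abs real_sqrt_less_iff abs_of_nonneg)+
        moreover from this(1) have "(H x)\<^sup>2 \<le> t \<longleftrightarrow> H x \<le> sqrt t" for x by (metis not_le)
        ultimately show ?thesis using levels[of "sqrt t"] that by simp
      qed
      then show "ennreal s * (indicator {0<..} t * prob {x\<in>space M. t < (H x)\<^sup>2})
         \<le> indicator {0<..} t * prob {x\<in>space M. t < (F x)\<^sup>2 \<and> (H x)\<^sup>2 \<le> t}"
        using s by (auto simp: indicator_def ennreal_mult[symmetric])
    qed
    also have "\<dots> = (\<integral>\<^sup>+t. \<integral>\<^sup>+x. indicator {0<..} t * indicator {t. t < (F x)\<^sup>2 \<and> (H x)\<^sup>2 \<le> t} t \<partial>M \<partial>lborel)"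
      by (intro nn_integral_cong)
         (auto simp: indicator_def emeasure_eq_measure[symmetric] simp flip: nn_integral_indicator intro!: nn_integral_cong)
    also have "\<dots> = (\<integral>\<^sup>+x. \<integral>\<^sup>+t. indicator {0<..} t * indicator {t. t < (F x)\<^sup>2 \<and> (H x)\<^sup>2 \<le> t} t \<partial>lborel \<partial>M)"
      by (rule L.Fubini') simp
    also have "\<dots> \<le> (\<integral>\<^sup>+x. ennreal (G x) \<partial>M)"
    proof (intro nn_integral_mono)
      fix x
      have "(\<integral>\<^sup>+t. indicator {0<..} t * indicator {t. t < (F x)\<^sup>2 \<and> (H x)\<^sup>2 \<le> t} t \<partial>lborel)
        \<le> (\<integral>\<^sup>+t. indicator {(H x)\<^sup>2..<(F x)\<^sup>2} t \<partial>lborel)"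
        by (intro nn_integral_mono) (auto simp: indicator_def)
      also have "\<dots> = ennreal (G x)"
        by (cases "(H x)\<^sup>2 \<le> (F x)\<^sup>2") (auto simp: G_def)
      finally show "(\<integral>\<^sup>+t. indicator {0<..} t * indicator {t. t < (F x)\<^sup>2 \<and> (H x)\<^sup>2 \<le> t} t \<partial>lborel) \<le> ennreal (G x)" .
    qed
    also have "\<dots> = ennreal (\<integral>x. G x \<partial>M)"
      using Gint by (intro nn_integral_eq_integral AE_I2) (simp_all, simp add: G_def)
    finally have "s * N \<le> (\<integral>x. G x \<partial>M)"
      by (subst (asm) ennreal_le_iff) (simp_all add: G_nonneg)
    with G_le have "s * N \<le> D / s" by simp
    then show ?thesis using s_pos by (simp add: N_def D_def field_simps power2_eq_square)
  qed
qed

text \<open>Positive and negative parts are treated separately by the previous lemma. Equality in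
  law supplies the equal second moments that it asks for, and the two estimates add up because
  splitting does not increase squared distances.\<close>

lemma L2_gap_of_level_sets:
  fixes F H :: "'a \<Rightarrow> real"
  assumes [measurable]: "F \<in> borel_measurable M" "H \<in> borel_measurable M"
    and distr: "distr M borel F = distr M borel H"
    and H2: "integrable M (\<lambda>x. (H x)\<^sup>2)"
    and s: "0 \<le> s"
    and upper: "\<And>t. 0 \<le> t \<Longrightarrow> s * prob {x\<in>space M. t < H x} \<le> prob {x\<in>space M. t < F x \<and> H x \<le> t}"
    and lower: "\<And>t. 0 \<le> t \<Longrightarrow> s * prob {x\<in>space M. H x < - t} \<le> prob {x\<in>space M. F x < - t \<and> - t \<le> H x}"
  shows "s\<^sup>2 * (\<integral>x. (H x)\<^sup>2 \<partial>M) \<le> (\<integral>x. (F x - H x)\<^sup>2 \<partial>M)"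
proof -
  have int_iff: "integrable M (\<lambda>x. \<phi> (F x)) \<longleftrightarrow> integrable M (\<lambda>x. \<phi> (H x))"
    and int_eq: "(\<integral>x. \<phi> (F x) \<partial>M) = (\<integral>x. \<phi> (H x) \<partial>M)"
    if [measurable]: "\<phi> \<in> borel_measurable borel" for \<phi> :: "real \<Rightarrow> real"
    using integrable_distr_eq[of F M borel \<phi>] integrable_distr_eq[of H M borel \<phi>]
      integral_distr[of F M borel \<phi>] integral_distr[of H M borel \<phi>] by (simp_all add: distr)
  define p n :: "real \<Rightarrow> real" where "p u = max 0 u" and "n u = max 0 (- u)" for u
  have [measurable]: "p \<in> borel_measurable borel" "n \<in> borel_measurable borel"
    by (simp_all add: p_def[abs_def] n_def[abs_def])
  have F2: "integrable M (\<lambda>x. (F x)\<^sup>2)" using int_iff[of "\<lambda>u. u\<^sup>2"] H2 by simp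
  have sq: "(p u)\<^sup>2 + (n u)\<^sup>2 = u\<^sup>2" for u by (auto simp: p_def n_def max_def)
  have bound: "(p u)\<^sup>2 \<le> u\<^sup>2" "(n u)\<^sup>2 \<le> u\<^sup>2" for u
    using sq[of u] by (metis le_add_same_cancel1 le_add_same_cancel2 zero_le_power2)+
  have int: "integrable M (\<lambda>x. (p (H x))\<^sup>2)" "integrable M (\<lambda>x. (n (H x))\<^sup>2)"
    by (rule Bochner_Integration.integrable_bound[OF H2]; simp add: bound)+
  have int': "integrable M (\<lambda>x. (p (F x))\<^sup>2)" "integrable M (\<lambda>x. (n (F x))\<^sup>2)"
    by (rule Bochner_Integration.integrable_bound[OF F2]; simp add: bound)+
  have *: "s\<^sup>2 * (\<integral>x. (p (H x))\<^sup>2 \<partial>M) \<le> (\<integral>x. (p (F x) - p (H x))\<^sup>2 \<partial>M)"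
  proof (rule level_sets_imp_L2_gap)
    fix t :: real assume "0 \<le> t"
    then have "t < p u \<longleftrightarrow> t < u" "p u \<le> t \<longleftrightarrow> u \<le> t" for u by (auto simp: p_def)
    then show "s * prob {x \<in> space M. t < p (H x)} \<le> prob {x \<in> space M. t < p (F x) \<and> p (H x) \<le> t}"
      using upper[OF \<open>0 \<le> t\<close>] by simp
  qed (use int int' s int_eq[of "\<lambda>u. (p u)\<^sup>2"] in \<open>auto simp: p_def\<close>)
  have **: "s\<^sup>2 * (\<integral>x. (n (H x))\<^sup>2 \<partial>M) \<le> (\<integral>x. (n (F x) - n (H x))\<^sup>2 \<partial>M)"
  proof (rule level_sets_imp_L2_gap)
    fix t :: real assume "0 \<le> t"
    then have "t < n u \<longleftrightarrow> u < - t" "n u \<le> t \<longleftrightarrow> - t \<le> u" for u by (auto simp: n_def)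
    then show "s * prob {x \<in> space M. t < n (H x)} \<le> prob {x \<in> space M. t < n (F x) \<and> n (H x) \<le> t}"
      using lower[OF \<open>0 \<le> t\<close>] by simp
  qed (use int int' s int_eq[of "\<lambda>u. (n u)\<^sup>2"] in \<open>auto simp: n_def\<close>)
  have diff_bound: "(u - v)\<^sup>2 \<le> 2 * u\<^sup>2 + 2 * v\<^sup>2" for u v :: real
    using zero_le_power2[of "u + v"] by (simp add: power2_sum power2_diff)
  have int_diff: "integrable M (\<lambda>x. (A x - B x)\<^sup>2)"
    if [measurable]: "A \<in> borel_measurable M" "B \<in> borel_measurable M"
      and "integrable M (\<lambda>x. (A x)\<^sup>2)" "integrable M (\<lambda>x. (B x)\<^sup>2)" for A B :: "'a \<Rightarrow> real"
    by (rule Bochner_Integration.integrable_bound[of _ "\<lambda>x. 2 * (A x)\<^sup>2 + 2 * (B x)\<^sup>2"])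
       (use that diff_bound in auto)
  have int_pn: "integrable M (\<lambda>x. (p (F x) - p (H x))\<^sup>2)" "integrable M (\<lambda>x. (n (F x) - n (H x))\<^sup>2)"
    by (intro int_diff int int'; measurable)+
  have "s\<^sup>2 * (\<integral>x. (H x)\<^sup>2 \<partial>M) = s\<^sup>2 * (\<integral>x. (p (H x))\<^sup>2 + (n (H x))\<^sup>2 \<partial>M)"
    by (simp only: sq)
  also have "\<dots> = s\<^sup>2 * (\<integral>x. (p (H x))\<^sup>2 \<partial>M) + s\<^sup>2 * (\<integral>x. (n (H x))\<^sup>2 \<partial>M)"
    using int by (simp add: distrib_left)
  also have "\<dots> \<le> (\<integral>x. (p (F x) - p (H x))\<^sup>2 \<partial>M) + (\<integral>x. (n (F x) - n (H x))\<^sup>2 \<partial>M)"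
    using * ** by simp
  also have "\<dots> = (\<integral>x. (p (F x) - p (H x))\<^sup>2 + (n (F x) - n (H x))\<^sup>2 \<partial>M)"
    using int_pn by simp
  also have "\<dots> \<le> (\<integral>x. (F x - H x)\<^sup>2 \<partial>M)"
  proof (rule integral_mono)
    show "integrable M (\<lambda>x. (F x - H x)\<^sup>2)" by (intro int_diff F2 H2; measurable)
    fix x
    define u v where "u = F x" and "v = H x"
    \<comment> \<open>\<open>p\<close> is nondecreasing and \<open>n\<close> is nonincreasing, so
      the cross term in the expansion of \<open>(u - v)\<^sup>2\<close> helps.\<close>
    have "(p u - p v) * (n u - n v) \<le> 0"
      by (auto simp: p_def n_def max_def mult_le_0_iff)
    moreover have "u - v = (p u - p v) - (n u - n v)"
      by (auto simp: p_def n_def max_def)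
    ultimately have "(p u - p v)\<^sup>2 + (n u - n v)\<^sup>2 \<le> (u - v)\<^sup>2"
      by (simp only: power2_diff[of "p u - p v" "n u - n v"])
    then show "(p (F x) - p (H x))\<^sup>2 + (n (F x) - n (H x))\<^sup>2 \<le> (F x - H x)\<^sup>2"
      by (simp add: u_def v_def)
  qed (use int_pn in simp)
  finally show ?thesis .
qed

text \<open>The median is the infimum of the points where the distribution function reaches 1/2.
  Right continuity controls the upper tail; the left limit, which leaves out a possible atom at
  \<open>m\<close>, controls the lower one.\<close>

lemma median_exists:
  fixes X :: "'a \<Rightarrow> real"
  assumes [measurable]: "X \<in> borel_measurable M"
  obtains m where "prob {x\<in>space M. m < X x} \<le> 1/2" "prob {x\<in>space M. X x < m} \<le> 1/2"
proof -
  define D where "D = distr M borel X"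
  interpret D: real_distribution D
    unfolding D_def by (rule real_distribution_distr) simp
  define S where "S = {t. 1/2 \<le> cdf D t}"
  have "\<forall>\<^sub>F t in at_top. 1/2 < cdf D t"
    by (rule order_tendstoD(1)[OF D.cdf_lim_at_top_prob]) simp
  then obtain t0 where "1/2 < cdf D t0" unfolding eventually_at_top_linorder by blast
  then have "t0 \<in> S" by (simp add: S_def)
  then have "S \<noteq> {}" by blast
  have "\<forall>\<^sub>F t in at_bot. cdf D t < 1/2"
    by (rule order_tendstoD(2)[OF D.cdf_lim_at_bot]) simp
  then obtain l where l: "\<And>t. t \<le> l \<Longrightarrow> cdf D t < 1/2" unfolding eventually_at_bot_linorder by blast
  have "bdd_below S"
  proof (rule bdd_belowI)
    fix t assume "t \<in> S"
    then have "\<not> cdf D t < 1/2" by (simp add: S_def)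
    then show "l \<le> t" using l[of t] by linarith
  qed
  define m where "m = Inf S"
  have above: "1/2 \<le> cdf D t" if "m < t" for t
  proof -
    have "\<exists>u\<in>S. u < t"
      by (rule iffD1[OF cInf_less_iff[OF \<open>S \<noteq> {}\<close> \<open>bdd_below S\<close>]]) (use that in \<open>simp add: m_def\<close>)
    then obtain u where "u \<in> S" "u < t" by blast
    then show ?thesis using D.cdf_nondecreasing[of u t] by (simp add: S_def)
  qed
  have below: "cdf D t \<le> 1/2" if "t < m" for t
    using cInf_lower[OF _ \<open>bdd_below S\<close>, of t] that by (force simp: m_def S_def)
  have "1/2 \<le> cdf D m"
  proof (rule tendsto_lowerbound)
    show "(cdf D \<longlongrightarrow> cdf D m) (at_right m)"
      using D.cdf_is_right_cont[of m] by (simp add: continuous_within)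
    show "\<forall>\<^sub>F t in at_right m. 1/2 \<le> cdf D t"
      using above by (auto simp: eventually_at_right_less eventually_at_filter)
  qed simp
  moreover have "measure D {..<m} \<le> 1/2"
  proof (rule tendsto_upperbound)
    show "(cdf D \<longlongrightarrow> measure D {..<m}) (at_left m)" by (rule D.cdf_at_left)
    show "\<forall>\<^sub>F t in at_left m. cdf D t \<le> 1/2"
      using below by (auto simp: eventually_at_filter)
  qed simp
  moreover have "measure D {..<m} = prob {x\<in>space M. X x < m}"
    by (simp add: D_def measure_distr) (rule arg_cong[where f=prob], auto)
  moreover have "cdf D m = 1 - prob {x\<in>space M. m < X x}"
  proof -
    have "cdf D m = prob {x\<in>space M. X x \<le> m}"
      by (simp add: D_def cdf_def measure_distr) (rule arg_cong[where f=prob], auto)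
    also have "{x\<in>space M. X x \<le> m} = space M - {x\<in>space M. m < X x}" by auto
    finally show ?thesis by (simp add: prob_compl)
  qed
  ultimately show ?thesis by (intro that[of m]) auto
qed

end

subsection \<open>Baire sets of a compact space\<close>

text \<open>A tube-lemma form of uniform continuity: compactness of the second factor lets one
  neighbourhood of \<open>x\<close> serve every \<open>t\<close>.\<close>

lemma continuous_on_prod_compact_nhd:
  fixes \<Phi> :: "'a::topological_space \<times> 'b::topological_space \<Rightarrow> 'c::metric_space"
  assumes "compact (UNIV :: 'b set)" "continuous_on UNIV \<Phi>" "0 < e"
  shows "\<exists>X. x \<in> X \<and> open X \<and> (\<forall>y\<in>X. \<forall>t. dist (\<Phi> (y, t)) (\<Phi> (x, t)) \<le> e)"
proof -
  have "continuous_on (UNIV \<times> UNIV) \<Phi>" using assms(2) by simp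
  then show ?thesis
    by (rule continuous_on_prod_compactE[OF _ assms(1) UNIV_I assms(3)]) auto
qed

text \<open>Without a countable base the Borel sets of the product may exceed the product sigma
  algebra, so continuity alone does not suffice. By compactness \<open>\<Phi>\<close> is a uniform
  limit of functions that, on each of finitely many pieces, depend on the second coordinate
  only.\<close>

lemma continuous_on_prod_compact_borel_measurable:
  fixes \<Phi> :: "'a::topological_space \<times> 'b::topological_space \<Rightarrow> real"
  assumes A: "compact (UNIV :: 'a set)" and B: "compact (UNIV :: 'b set)"
    and \<Phi>: "continuous_on UNIV \<Phi>"
  shows "\<Phi> \<in> borel_measurable (borel \<Otimes>\<^sub>M borel)"
proof -
  have approx: "\<exists>\<Psi>\<in>borel_measurable (borel \<Otimes>\<^sub>M borel). \<forall>p. \<bar>\<Psi> p - \<Phi> p\<bar> \<le> e" if "e > 0" for e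
  proof -
    have "\<exists>W. x \<in> W \<and> open W \<and> (\<forall>y\<in>W. \<forall>t. dist (\<Phi> (y, t)) (\<Phi> (x, t)) \<le> e)" for x
      by (rule continuous_on_prod_compact_nhd[OF B \<Phi> \<open>0 < e\<close>])
    then obtain W where W: "\<And>x. x \<in> W x" "\<And>x. open (W x)"
      "\<And>x y t. y \<in> W x \<Longrightarrow> dist (\<Phi> (y, t)) (\<Phi> (x, t)) \<le> e"
      by metis
    obtain C where C: "finite C" "UNIV \<subseteq> (\<Union>c\<in>C. W c)"
    proof (rule compactE_image[OF A, of UNIV W])
      show "UNIV \<subseteq> (\<Union>c\<in>UNIV. W c)" using W(1) by blast
    qed (use W(2) in auto)
    have slice: "(\<lambda>p. \<Phi> (c, snd p)) \<in> borel_measurable (borel \<Otimes>\<^sub>M borel)" for c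
    proof -
      have "(\<lambda>t. \<Phi> (c, t)) \<in> borel_measurable borel"
        by (intro borel_measurable_continuous_onI continuous_on_compose2[OF \<Phi>] continuous_intros) auto
      then show ?thesis
        by (rule measurable_compose[OF measurable_snd])
    qed
    \<comment> \<open>Induction on the finite cover avoids making it disjoint: on overlaps the most
      recently added \<open>W c\<close> takes precedence.\<close>
    have "\<exists>\<Psi>\<in>borel_measurable (borel \<Otimes>\<^sub>M borel). \<forall>a\<in>(\<Union>c\<in>C. W c). \<forall>t. \<bar>\<Psi> (a, t) - \<Phi> (a, t)\<bar> \<le> e"
      using C(1)
    proof induction
      case empty
      then show ?case by (intro bexI[of _ "\<lambda>_. 0"]) auto
    next
      case (insert c C)
      then obtain \<Psi> where [measurable]: "\<Psi> \<in> borel_measurable (borel \<Otimes>\<^sub>M borel)"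
        and \<Psi>: "\<And>a t. a \<in> (\<Union>c\<in>C. W c) \<Longrightarrow> \<bar>\<Psi> (a, t) - \<Phi> (a, t)\<bar> \<le> e" by auto
      note slice[measurable]
      have [measurable]: "W c \<in> sets borel" using W(2) by simp
      show ?case
      proof (intro bexI[of _ "\<lambda>p. if fst p \<in> W c then \<Phi> (c, snd p) else \<Psi> p"])
        show "\<forall>a\<in>\<Union> (W ` insert c C). \<forall>t. \<bar>(if fst (a, t) \<in> W c then \<Phi> (c, snd (a, t)) else \<Psi> (a, t)) - \<Phi> (a, t)\<bar> \<le> e"
          using \<Psi> W(3)[of _ c] by (auto simp: dist_real_def abs_minus_commute)
      qed measurable
    qed
    then show ?thesis using C(2) by (metis UNIV_I subsetD surj_pair)
  qed
  have "\<exists>\<Psi>. \<Psi> \<in> borel_measurable (borel \<Otimes>\<^sub>M borel) \<and> (\<forall>p. \<bar>\<Psi> p - \<Phi> p\<bar> \<le> 1 / real (Suc n))" for n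
    using approx[of "1 / real (Suc n)"] unfolding Bex_def by (simp del: of_nat_Suc)
  then obtain \<Psi> where \<Psi>: "\<And>n. \<Psi> n \<in> borel_measurable (borel \<Otimes>\<^sub>M borel)"
    "\<And>n p. \<bar>\<Psi> n p - \<Phi> p\<bar> \<le> 1 / real (Suc n)"
    by metis
  show ?thesis
  proof (rule borel_measurable_LIMSEQ_real[OF _ \<Psi>(1)])
    fix p
    have "(\<lambda>n. \<Psi> n p - \<Phi> p) \<longlonglongrightarrow> 0"
      using \<Psi>(2) by (intro Lim_null_comparison[OF _ LIMSEQ_inverse_real_of_nat]) (auto simp: inverse_eq_divide)
    then show "(\<lambda>n. \<Psi> n p) \<longlonglongrightarrow> \<Phi> p" by (rule LIM_zero_cancel)
  qed
qed

text \<open>The Baire sigma algebra, the smallest one for which all continuous real functions are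
  measurable. It is packaged as a measure space only to be used as a measurability target.\<close>

definition baire :: "'a::topological_space measure" where
  "baire = sigma UNIV {{x. 0 < g x} | g :: 'a \<Rightarrow> real. continuous_on UNIV g}"

lemma space_baire [simp]: "space baire = UNIV"
  by (simp add: baire_def space_measure_of_conv)

lemma cozero_in_baire: "continuous_on UNIV g \<Longrightarrow> {x. 0 < (g x :: real)} \<in> sets baire"
  by (auto simp: baire_def sets_measure_of_conv intro!: sigma_sets.Basic)

lemma measurable_baireI:
  assumes "\<And>g :: 'b::topological_space \<Rightarrow> real. continuous_on UNIV g \<Longrightarrow> (\<lambda>x. g (f x)) \<in> borel_measurable M"
  shows "f \<in> measurable M baire"
  unfolding baire_def
proof (rule measurable_measure_of)
  fix A :: "'b set" assume "A \<in> {{x. 0 < g x} | g :: 'b \<Rightarrow> real. continuous_on UNIV g}"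
  then obtain g :: "'b \<Rightarrow> real" where g: "A = {x. 0 < g x}" "continuous_on UNIV g" by blast
  have [measurable]: "(\<lambda>x. g (f x)) \<in> borel_measurable M" using assms g by auto
  have "f -` A \<inter> space M = {x \<in> space M. 0 < g (f x)}" unfolding g(1) by blast
  moreover have "\<dots> \<in> sets M" by measurable
  ultimately show "f -` A \<inter> space M \<in> sets M" by simp
qed simp_all

lemma continuous_on_baire_measurable:
  fixes g :: "'a::topological_space \<Rightarrow> real"
  assumes "continuous_on UNIV g"
  shows "g \<in> borel_measurable baire"
  unfolding borel_measurable_iff_greater
proof
  fix a :: real
  have "{x. 0 < g x - a} \<in> sets baire"
    by (intro cozero_in_baire continuous_intros assms)
  then show "{w \<in> space baire. a < g w} \<in> sets baire" by simp
qed

lemma measurable_borel_baire: "continuous_on UNIV f \<Longrightarrow> f \<in> measurable borel baire"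
  by (intro measurable_baireI borel_measurable_continuous_onI) (auto intro: continuous_on_compose2)

lemma measurable_baire_baire: "continuous_on UNIV f \<Longrightarrow> f \<in> measurable baire baire"
  by (intro measurable_baireI continuous_on_baire_measurable) (auto intro: continuous_on_compose2)

lemma baire_in_borel: "A \<in> sets baire \<Longrightarrow> A \<in> sets borel"
  using measurable_sets[OF measurable_borel_baire[of "\<lambda>x. x"], of A] by simp

text \<open>It suffices to test against continuous real functions, whose composition with
  \<open>f\<close> is continuous on a product of compact spaces. This gives the group operations the
  measurability needed for Fubini.\<close>

lemma measurable_baire_prod:
  fixes f :: "'a::topological_space \<times> 'b::topological_space \<Rightarrow> 'c::topological_space"
  assumes "compact (UNIV :: 'a set)" "compact (UNIV :: 'b set)" "continuous_on UNIV f"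
  shows "f \<in> measurable (borel \<Otimes>\<^sub>M borel) baire"
  by (intro measurable_baireI continuous_on_prod_compact_borel_measurable assms)
    (use assms(3) in \<open>auto intro: continuous_on_compose2\<close>)

lemma t2_Hausdorff_space: "Hausdorff_space (euclidean :: 'a::t2_space topology)"
  unfolding Hausdorff_space_def disjnt_def
proof (intro allI impI)
  fix x y :: 'a
  assume "x \<in> topspace euclidean \<and> y \<in> topspace euclidean \<and> x \<noteq> y"
  then show "\<exists>U V. openin euclidean U \<and> openin euclidean V \<and> x \<in> U \<and> y \<in> V \<and> U \<inter> V = {}"
    using hausdorff[of x y] by (simp flip: open_openin)
qed
lemma compact_Urysohn:
  fixes K U :: "'a::t2_space set"
  assumes "compact (UNIV :: 'a set)" "compact K" "open U" "K \<subseteq> U"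
  obtains g :: "'a \<Rightarrow> real" where "continuous_on UNIV g" "\<And>x. 0 \<le> g x" "\<And>x. g x \<le> 1"
    "\<And>x. x \<in> K \<Longrightarrow> g x = 1" "\<And>x. x \<notin> U \<Longrightarrow> g x = 0"
proof -
  have "normal_space (euclidean :: 'a topology)"
    using assms(1) t2_Hausdorff_space by (intro compact_Hausdorff_or_regular_imp_normal_space disjI1) (simp_all add: compact_space_def)
  moreover have "closedin euclidean (- U)" "closedin euclidean K"
    using compact_imp_closed[OF assms(2)] assms(3) by (simp_all add: closed_Compl flip: closed_closedin)
  moreover have "disjnt (- U) K" using assms by (auto simp: disjnt_def)
  moreover have "(0::real) \<le> 1" by simp
  ultimately obtain g :: "'a \<Rightarrow> real" where g: "continuous_map euclidean (top_of_set {0..1}) g" "g ` (- U) \<subseteq> {0}" "g ` K \<subseteq> {1}"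
    by (rule Urysohn_lemma)
  have range: "g x \<in> {0..1}" for x
    using g(1) by (auto simp: continuous_map_in_subtopology)
  show ?thesis
  proof (rule that)
    show "continuous_on UNIV g" using g(1) by (simp add: continuous_map_in_subtopology)
    show "0 \<le> g x" "g x \<le> 1" for x using range[of x] by auto
    show "g x = 1" if "x \<in> K" for x using g(3) that by auto
    show "g x = 0" if "x \<notin> U" for x using g(2) that by auto
  qed
qed

lemma continuous_on_uniform_approx:
  fixes f :: "'a::topological_space \<Rightarrow> real"
  assumes "\<And>e. 0 < e \<Longrightarrow> \<exists>h. continuous_on UNIV h \<and> (\<forall>x. \<bar>h x - f x\<bar> \<le> e)"
  shows "continuous_on UNIV f"
  unfolding continuous_on_def
proof (intro ballI tendstoI)
  fix x and e :: real assume "0 < e"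
  then obtain h where h: "continuous_on UNIV h" "\<And>x. \<bar>h x - f x\<bar> \<le> e / 3"
    using assms[of "e / 3"] by auto
  have "\<forall>\<^sub>F y in at x. dist (h y) (h x) < e / 3"
    using h(1) \<open>0 < e\<close> by (intro tendstoD) (auto simp: continuous_on_def)
  then show "\<forall>\<^sub>F y in at x. dist (f y) (f x) < e"
  proof eventually_elim
    case (elim y)
    then show ?case using h(2)[of x] h(2)[of y] unfolding dist_real_def by argo
  qed
qed

text \<open>Needed because \<open>L2_inner\<close> integrates over the completion, while the average
  of a Borel function is only known to agree almost everywhere with a measurable function.\<close>

lemma borel_measurable_completion_AE_eq:
  fixes h :: "'a \<Rightarrow> 'b::topological_space"
  assumes g: "g \<in> borel_measurable M" and eq: "AE x in M. h x = g x"
  shows "h \<in> borel_measurable (completion M)"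
proof (rule measurableI)
  fix A :: "'b set" assume "A \<in> sets borel"
  then have A: "g -` A \<inter> space M \<in> sets (completion M)"
    using measurable_sets[OF g] by auto
  have AE: "AE x in completion M. x \<in> g -` A \<inter> space M \<longleftrightarrow> x \<in> h -` A \<inter> space (completion M)"
    using AE_completion[OF eq] by eventually_elim auto
  show "h -` A \<inter> space (completion M) \<in> sets (completion M)"
    by (rule completion.in_sets_AE[OF AE A]) auto
qed simp

subsection \<open>Completion regularity of Haar measure\<close>

locale compact_haar =
  fixes \<mu> :: "'a::{topological_group_add, t2_space} measure"
  assumes compact_UNIV: "compact (UNIV :: 'a set)" and haar: "normalized_haar \<mu>"
begin

lemma sets_\<mu> [measurable_cong, simp]: "sets \<mu> = sets borel"
  using haar by (simp add: normalized_haar_def borel_prob_def)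

lemma space_\<mu> [simp]: "space \<mu> = UNIV"
  using sets_eq_imp_space_eq[OF sets_\<mu>] by simp

sublocale prob_space \<mu>
  using haar by (simp add: normalized_haar_def borel_prob_def)

lemma outer_regular: "A \<in> sets borel \<Longrightarrow> emeasure \<mu> A = (INF U\<in>{U. open U \<and> A \<subseteq> U}. emeasure \<mu> U)"
  using haar unfolding normalized_haar_def by blast

lemma inner_regular_open: "open U \<Longrightarrow> emeasure \<mu> U = (SUP K\<in>{K. compact K \<and> K \<subseteq> U}. emeasure \<mu> K)"
  using haar unfolding normalized_haar_def by blast

lemma continuous_on_left: "continuous_on UNIV (\<lambda>x. a + x :: 'a)"
  and continuous_on_right: "continuous_on UNIV (\<lambda>x. x + a :: 'a)"
  by (intro continuous_intros)+

lemma image_left: "(+) a ` A = {x::'a. - a + x \<in> A}"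
proof
  show "{x. - a + x \<in> A} \<subseteq> (+) a ` A"
  proof
    fix x assume "x \<in> {x. - a + x \<in> A}"
    moreover have "x = a + (- a + x)" by (simp add: add.assoc[symmetric])
    ultimately show "x \<in> (+) a ` A" by blast
  qed
qed (auto simp: add.assoc[symmetric])

lemma emeasure_left: "A \<in> sets borel \<Longrightarrow> emeasure \<mu> {x. a + x \<in> A} = emeasure \<mu> A"
  using haar image_left[of "- a" A] unfolding normalized_haar_def by (metis add.inverse_inverse)

lemma measurable_left [measurable]: "(\<lambda>x. a + x :: 'a) \<in> measurable borel borel"
  by (intro borel_measurable_continuous_onI continuous_on_left)

lemma measurable_right [measurable]: "(\<lambda>x. x + a :: 'a) \<in> measurable borel borel"
  by (intro borel_measurable_continuous_onI continuous_on_right)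

lemma left_vimage_borel: "A \<in> sets borel \<Longrightarrow> {x::'a. a + x \<in> A} \<in> sets borel"
  using measurable_sets[OF measurable_left, of A a] by (simp add: vimage_def)

lemma open_left_vimage: "open U \<Longrightarrow> open {x::'a. a + x \<in> U}"
  using open_vimage[OF _ continuous_on_left, of U a] by (simp add: vimage_def)

text \<open>The restriction of \<open>\<mu>\<close> to the Baire sets, written as the image of
  \<open>\<mu>\<close> under the identity.\<close>

definition \<beta> :: "'a measure" where
  "\<beta> = distr \<mu> baire (\<lambda>x. x)"

lemma measurable_id_baire [measurable]: "(\<lambda>x::'a. x) \<in> measurable borel baire"
  by (intro measurable_borel_baire continuous_intros)

lemma sets_\<beta> [measurable_cong, simp]: "sets \<beta> = sets baire"
  and space_\<beta> [simp]: "space \<beta> = UNIV"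
  by (simp_all add: \<beta>_def)

lemma emeasure_\<beta>: "A \<in> sets baire \<Longrightarrow> emeasure \<beta> A = emeasure \<mu> A"
  by (simp add: \<beta>_def emeasure_distr measurable_id_baire)

text \<open>Countably many compact subsets of \<open>U\<close> exhaust its measure. A geometrically
  weighted sum of their Urysohn functions converges uniformly, hence is continuous, and is positive
  on all of them but nowhere outside \<open>U\<close>.\<close>

lemma inner_cozero:
  assumes "open U"
  obtains g :: "'a \<Rightarrow> real" where "continuous_on UNIV g" "\<And>x. 0 \<le> g x" "{x. 0 < g x} \<subseteq> U"
    "emeasure \<mu> {x. 0 < g x} = emeasure \<mu> U"
proof -
  have "{K. compact K \<and> K \<subseteq> U} \<noteq> {}" by auto
  from ennreal_SUP_countable_SUP[OF this, of "emeasure \<mu>"]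
  obtain v :: "nat \<Rightarrow> ennreal" where v: "range v \<subseteq> emeasure \<mu> ` {K. compact K \<and> K \<subseteq> U}"
    "Sup (emeasure \<mu> ` {K. compact K \<and> K \<subseteq> U}) = Sup (range v)" by auto
  then have "\<exists>K. compact K \<and> K \<subseteq> U \<and> v n = emeasure \<mu> K" for n by blast
  then obtain K where K: "\<And>n. compact (K n)" "\<And>n. K n \<subseteq> U" "\<And>n. v n = emeasure \<mu> (K n)" by metis
  have "\<exists>g :: 'a \<Rightarrow> real. continuous_on UNIV g \<and> (\<forall>x. 0 \<le> g x \<and> g x \<le> 1) \<and> (\<forall>x\<in>K n. g x = 1) \<and> (\<forall>x. x \<notin> U \<longrightarrow> g x = 0)" for n
    by (rule compact_Urysohn[OF compact_UNIV K(1) assms K(2)]) blast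
  then obtain g :: "nat \<Rightarrow> 'a \<Rightarrow> real" where g: "\<And>n. continuous_on UNIV (g n)" "\<And>n x. 0 \<le> g n x" "\<And>n x. g n x \<le> 1"
    "\<And>n x. x \<in> K n \<Longrightarrow> g n x = 1" "\<And>n x. x \<notin> U \<Longrightarrow> g n x = 0" by metis
  define h where "h x = (\<Sum>n. (1/2)^n * g n x)" for x
  have bound: "norm ((1/2)^n * g n x) \<le> (1/2)^n" for n x
    using g(2,3)[of n x] by (simp add: mult_left_le)
  have summable: "summable (\<lambda>n. (1/2)^n * g n x)" for x
    by (rule summable_comparison_test'[OF summable_geometric[of "1/2"]]) (use bound in auto)
  have "uniform_limit UNIV (\<lambda>n x. \<Sum>i<n. (1/2)^i * g i x) h sequentially"
    unfolding h_def by (rule Weierstrass_m_test[OF bound]) (simp add: summable_geometric)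
  then have cont: "continuous_on UNIV h"
    by (rule uniform_limit_theorem[rotated]) (auto intro!: always_eventually continuous_intros g)
  have pos: "0 < h x \<longleftrightarrow> (\<exists>n. 0 < g n x)" for x
  proof
    assume "0 < h x"
    show "\<exists>n. 0 < g n x"
    proof (rule ccontr)
      assume "\<nexists>n. 0 < g n x"
      then have "g n x = 0" for n using g(2)[of n x] by (simp add: not_less antisym)
      then have "h x = 0" by (simp add: h_def)
      with \<open>0 < h x\<close> show False by simp
    qed
  next
    assume "\<exists>n. 0 < g n x"
    then obtain n where "0 < g n x" by auto
    then have "0 < (1/2)^n * g n x" by (intro mult_pos_pos) auto
    then show "0 < h x" unfolding h_def by (intro suminf_pos2[OF summable]) (use g(2) in auto)
  qed
  show ?thesis
  proof (rule that[OF cont])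
    show "0 \<le> h x" for x unfolding h_def by (intro suminf_nonneg summable) (use g(2) in auto)
    show sub: "{x. 0 < h x} \<subseteq> U" using g(5) by (force simp: pos)
    have meas: "{x. 0 < h x} \<in> sets borel" using cozero_in_baire[OF cont] by (rule baire_in_borel)
    have "K n \<subseteq> {x. 0 < h x}" for n
    proof
      fix x assume "x \<in> K n"
      then have "0 < g n x" using g(4) by simp
      then show "x \<in> {x. 0 < h x}" using pos by blast
    qed
    then have "Sup (range v) \<le> emeasure \<mu> {x. 0 < h x}"
      using meas K(3) by (auto intro!: SUP_least emeasure_mono)
    then have "emeasure \<mu> U \<le> emeasure \<mu> {x. 0 < h x}"
      using inner_regular_open[OF assms] v(2) by simp
    moreover have "emeasure \<mu> {x. 0 < h x} \<le> emeasure \<mu> U"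
      using sub assms by (intro emeasure_mono) auto
    ultimately show "emeasure \<mu> {x. 0 < h x} = emeasure \<mu> U" by simp
  qed
qed

text \<open>
  The elements \<open>h\<close> with \<open>g (h + z) = g z\<close> for all \<open>z\<close> form a closed subgroup \<open>H\<close>, and \<open>S\<close> is \<open>H + U\<close>. It is a
  cozero set because \<open>x \<mapsto> (\<lambda>z. g (x + z))\<close> identifies the quotient by \<open>H\<close> with a compact subset of
  a metric space. Each translate of \<open>U\<close> by an element of \<open>H\<close> agrees with \<open>{x. 0 < g x}\<close> up to a null set,
  and inner regularity reduces the union over \<open>H\<close> to a finite one.
\<close>

lemma saturation:
  fixes g :: "'a \<Rightarrow> real"
  assumes U: "open U" and g: "continuous_on UNIV g" and V: "{x. 0 < g x} \<subseteq> U"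
    and eq: "emeasure \<mu> {x. 0 < g x} = emeasure \<mu> U"
  defines "S \<equiv> {y. \<exists>x\<in>U. \<forall>z. g (y + z) = g (x + z)}"
  shows "S \<in> sets baire" "U \<subseteq> S" "emeasure \<mu> S = emeasure \<mu> U"
proof -
  show "U \<subseteq> S" by (auto simp: S_def)
  define H where "H = {h. \<forall>z. g (h + z) = g z}"
  have S_eq: "S = (\<Union>h\<in>H. {y. h + y \<in> U})"
  proof (intro set_eqI iffI)
    fix y assume "y \<in> S"
    then obtain x where x: "x \<in> U" "\<And>z. g (y + z) = g (x + z)" by (auto simp: S_def)
    have "g (x + - y + z) = g z" for z
      using x(2)[of "- y + z"] by (simp add: add.assoc[symmetric])
    then have "x + - y \<in> H" by (simp add: H_def)
    moreover have "(x + - y) + y = x" by (simp add: add.assoc)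
    ultimately show "y \<in> (\<Union>h\<in>H. {y. h + y \<in> U})" using x(1) by force
  next
    fix y assume "y \<in> (\<Union>h\<in>H. {y. h + y \<in> U})"
    then obtain h where "h \<in> H" "h + y \<in> U" by auto
    then show "y \<in> S" by (auto simp: S_def H_def add.assoc intro!: bexI[of _ "h + y"])
  qed
  have open_S: "open S" unfolding S_eq by (intro open_UN ballI open_left_vimage U)
  show "S \<in> sets baire"
  \<comment> \<open>The distance to the empty set is 0 by convention, so the description of
    \<open>S\<close> by \<open>infdist\<close> below would fail when its complement is
    empty.\<close>
  proof (cases "S = UNIV")
    case True
    then show ?thesis using sets.top[of "baire :: 'a measure"] by simp
  next
    case False
    define \<Gamma> where "\<Gamma> x = Bcontfun (\<lambda>z. g (x + z))" for x
    have "(\<lambda>z. g (x + z)) \<in> bcontfun" for x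
    proof -
      have "continuous_on UNIV (\<lambda>z. g (x + z))"
        by (intro continuous_on_compose2[OF g] continuous_intros) auto
      then show ?thesis
        using compact_imp_bounded[OF compact_continuous_image[OF _ compact_UNIV]] by (auto simp: bcontfun_def)
    qed
    then have \<Gamma>: "apply_bcontfun (\<Gamma> x) z = g (x + z)" for x z
      by (simp add: \<Gamma>_def Bcontfun_inverse)
    have "continuous_on UNIV \<Gamma>"
      unfolding continuous_on_def
    proof (intro ballI tendstoI)
      fix x and e :: real assume "0 < e"
      have "continuous_on UNIV (\<lambda>p. g (fst p + snd p))"
        by (intro continuous_on_compose2[OF g] continuous_intros) auto
      from continuous_on_prod_compact_nhd[OF compact_UNIV this, of "e / 2" x] \<open>0 < e\<close>
      obtain X where X: "x \<in> X" "open X" "\<And>y t. y \<in> X \<Longrightarrow> dist (g (y + t)) (g (x + t)) \<le> e / 2" by auto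
      have "dist (\<Gamma> y) (\<Gamma> x) < e" if "y \<in> X" for y
      proof -
        have "dist (\<Gamma> y) (\<Gamma> x) \<le> e / 2"
          by (intro dist_bound) (use X(3)[OF that] in \<open>simp add: \<Gamma>\<close>)
        then show ?thesis using \<open>0 < e\<close> by simp
      qed
      then show "\<forall>\<^sub>F y in at x. dist (\<Gamma> y) (\<Gamma> x) < e"
        using X(1,2) unfolding eventually_at_topological by blast
    qed
    moreover have "compact (- S)"
      using open_S compact_Int_closed[OF compact_UNIV, of "- S"] by (simp add: closed_Compl)
    ultimately have "compact (\<Gamma> ` (- S))"
      by (intro compact_continuous_image) (auto intro: continuous_on_subset)
    then have "closed (\<Gamma> ` (- S))" by (rule compact_imp_closed)
    \<comment> \<open>\<open>S\<close> is a union of fibres of \<open>\<Gamma>\<close>, so the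
      images of \<open>S\<close> and of its complement are disjoint.\<close>
    have "\<Gamma> y \<in> \<Gamma> ` (- S) \<longleftrightarrow> y \<notin> S" for y
    proof
      assume "\<Gamma> y \<in> \<Gamma> ` (- S)"
      then obtain w where w: "w \<notin> S" "\<Gamma> y = \<Gamma> w" by auto
      then have "g (y + z) = g (w + z)" for z using \<Gamma> by metis
      then show "y \<notin> S" using w(1) unfolding S_def by auto
    qed auto
    then have "y \<in> S \<longleftrightarrow> 0 < infdist (\<Gamma> y) (\<Gamma> ` (- S))" for y
      using in_closed_iff_infdist_zero[OF \<open>closed (\<Gamma> ` (- S))\<close>, of "\<Gamma> y"] infdist_nonneg[of "\<Gamma> y" "\<Gamma> ` (- S)"] False
      by (auto simp: less_le)
    then have "S = {y. 0 < infdist (\<Gamma> y) (\<Gamma> ` (- S))}" by blast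
    moreover have "\<dots> \<in> sets baire"
      by (intro cozero_in_baire continuous_on_infdist) fact
    ultimately show ?thesis by simp
  qed
  define V where "V = {x. 0 < g x}"
  have V_borel: "V \<in> sets borel" unfolding V_def using cozero_in_baire[OF g] by (rule baire_in_borel)
  have null: "{y. h + y \<in> U} - V \<in> null_sets \<mu>" if "h \<in> H" for h
  proof -
    have "{y. h + y \<in> U} - V = {y. h + y \<in> U - V}"
      using that by (auto simp: H_def V_def)
    moreover have "emeasure \<mu> (U - V) = 0"
      using eq V U V_borel by (subst emeasure_Diff) (auto simp: V_def)
    ultimately show ?thesis
      using emeasure_left[of "U - V" h] left_vimage_borel[of "U - V" h] U V_borel by (simp add: null_sets_def)
  qed
  have "emeasure \<mu> K \<le> emeasure \<mu> U" if K: "compact K" "K \<subseteq> S" for K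
  proof -
    obtain D where D: "D \<subseteq> H" "finite D" "K \<subseteq> (\<Union>h\<in>D. {y. h + y \<in> U})"
      using compactE_image[OF K(1), of H "\<lambda>h. {y. h + y \<in> U}"] open_left_vimage[OF U] K(2) S_eq by metis
    define N where "N = (\<Union>h\<in>D. {y. h + y \<in> U} - V)"
    have N: "N \<in> null_sets \<mu>"
      unfolding N_def using D null by (intro null_sets_UN') (auto simp: countable_finite)
    have "emeasure \<mu> K \<le> emeasure \<mu> (V \<union> N)"
    proof (rule emeasure_mono)
      show "K \<subseteq> V \<union> N" using D(3) by (auto simp: N_def)
    qed (use null_setsD2[OF N] V_borel in auto)
    also have "\<dots> = emeasure \<mu> V" using N V_borel by (intro emeasure_Un_null_set) auto
    finally show ?thesis using eq by (simp add: V_def)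
  qed
  then have "emeasure \<mu> S \<le> emeasure \<mu> U"
    using inner_regular_open[OF open_S] by (auto intro!: SUP_least)
  moreover have "emeasure \<mu> U \<le> emeasure \<mu> S"
    using \<open>U \<subseteq> S\<close> open_S by (intro emeasure_mono) auto
  ultimately show "emeasure \<mu> S = emeasure \<mu> U" by simp
qed

text \<open>Every open \<open>U\<close> lies between two Baire sets of equal measure, the cozero set
  \<open>V\<close> from inside and its saturation \<open>S\<close> from outside. Hence every Borel
  set belongs to the completion of the Baire sets.\<close>

lemma borel_measurable_completion_\<beta>: "(\<lambda>x. x) \<in> measurable (completion \<beta>) borel"
proof (rule borel_measurableI)
  fix U :: "'a set" assume U: "open U"
  obtain g :: "'a \<Rightarrow> real" where g: "continuous_on UNIV g" "{x. 0 < g x} \<subseteq> U" "emeasure \<mu> {x. 0 < g x} = emeasure \<mu> U"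
    using inner_cozero[OF U] by metis
  define V where "V = {x. 0 < g x}"
  define S where "S = {y. \<exists>x\<in>U. \<forall>z. g (y + z) = g (x + z)}"
  have V: "V \<in> sets baire" unfolding V_def by (rule cozero_in_baire[OF g(1)])
  have S: "S \<in> sets baire" "U \<subseteq> S" "emeasure \<mu> S = emeasure \<mu> U"
    unfolding S_def using saturation[OF U g] by blast+
  have "emeasure \<mu> (S - V) = 0"
    using g(2,3) S V baire_in_borel[OF V] baire_in_borel[OF S(1)] by (subst emeasure_Diff) (auto simp: V_def)
  then have "S - V \<in> null_sets \<beta>"
    using S V by (simp add: null_sets_def emeasure_\<beta>)
  then have "U \<in> sets (completion \<beta>)"
    using S(2) g(2) V by (intro sets_completionI[of U V "U - V" "S - V"]) (auto simp: V_def)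
  then show "(\<lambda>x. x) -` U \<inter> space (completion \<beta>) \<in> sets (completion \<beta>)" by simp
qed

text \<open>The exceptional set is itself chosen Baire, so that the set of pairs whose sum falls
  into it is measurable in the product.\<close>

lemma baire_version:
  fixes f :: "'a \<Rightarrow> real"
  assumes "f \<in> borel_measurable borel"
  obtains f' N where "f' \<in> borel_measurable baire" "N \<in> sets baire" "emeasure \<mu> N = 0" "\<And>x. x \<notin> N \<Longrightarrow> f x = f' x"
proof -
  have "f \<in> borel_measurable (completion \<beta>)"
    using measurable_compose[OF borel_measurable_completion_\<beta> assms] .
  then obtain f' where f': "f' \<in> borel_measurable \<beta>" "AE x in \<beta>. f x = f' x"
    using completion_ex_borel_measurable_real by blast
  from AE_E[OF f'(2)] obtain N where "{x \<in> space \<beta>. f x \<noteq> f' x} \<subseteq> N" "emeasure \<beta> N = 0" "N \<in> sets \<beta>" .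
  then show ?thesis
    using f'(1) by (intro that[of f' N]) (auto simp: emeasure_\<beta>)
qed

lemma plus_baire [measurable]: "(\<lambda>p. fst p + snd p :: 'a) \<in> measurable (borel \<Otimes>\<^sub>M borel) baire"
  and plus_swap_baire [measurable]: "(\<lambda>p. snd p + fst p :: 'a) \<in> measurable (borel \<Otimes>\<^sub>M borel) baire"
  and minus_baire [measurable]: "(\<lambda>p. - fst p + snd p :: 'a) \<in> measurable (borel \<Otimes>\<^sub>M borel) baire"
  by (intro measurable_baire_prod compact_UNIV continuous_intros)+

lemma snd_baire [measurable]: "(snd :: 'a \<times> 'a \<Rightarrow> 'a) \<in> measurable (borel \<Otimes>\<^sub>M borel) baire"
  by (rule measurable_compose[OF measurable_snd measurable_id_baire])

lemma left_baire [measurable]: "(\<lambda>x. a + x :: 'a) \<in> measurable baire baire"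
  and right_baire [measurable]: "(\<lambda>x. x + a :: 'a) \<in> measurable baire baire"
  by (intro measurable_baire_baire continuous_intros)+

lemma left_vimage_baire: "A \<in> sets baire \<Longrightarrow> {x::'a. a + x \<in> A} \<in> sets baire"
  and right_vimage_baire: "A \<in> sets baire \<Longrightarrow> {x::'a. x + a \<in> A} \<in> sets baire"
  using measurable_sets[OF left_baire, of A a] measurable_sets[OF right_baire, of A a] by (simp_all add: vimage_def)

lemma emeasure_left_baire: "A \<in> sets baire \<Longrightarrow> emeasure \<mu> {x. a + x \<in> A} = emeasure \<mu> A"
  by (rule emeasure_left[OF baire_in_borel])

subsection \<open>Right translates\<close>

text \<open>
  Both sides are the measure of \<open>{(x, g). - x + g \<in> A}\<close>, computed by the two iterated integrals.
\<close>

lemma emeasure_reflect: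
  assumes A [measurable]: "A \<in> sets baire"
  shows "emeasure \<mu> {x. - x \<in> A} = emeasure \<mu> A"
proof -
  interpret H: pair_prob_space \<mu> \<mu> ..
  have uminus: "continuous_on UNIV (\<lambda>x::'a. - x)" by (intro continuous_intros)
  have refl: "{x. - x \<in> A} \<in> sets borel"
    using measurable_sets[OF measurable_borel_baire[OF uminus] A] by (simp add: vimage_def)
  define E where "E = {p. - fst p + snd p \<in> A}"
  have E: "E \<in> sets (\<mu> \<Otimes>\<^sub>M \<mu>)"
  proof -
    have "{p \<in> space (\<mu> \<Otimes>\<^sub>M \<mu>). - fst p + snd p \<in> A} \<in> sets (\<mu> \<Otimes>\<^sub>M \<mu>)" by measurable
    then show ?thesis by (simp add: E_def space_pair_measure)
  qed
  have "emeasure (\<mu> \<Otimes>\<^sub>M \<mu>) E = (\<integral>\<^sup>+x. emeasure \<mu> {g. - x + g \<in> A} \<partial>\<mu>)"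
    unfolding emeasure_pair_measure_alt[OF E] by (simp add: E_def vimage_def)
  also have "\<dots> = emeasure \<mu> A"
    by (simp add: emeasure_left_baire A emeasure_space_1[simplified])
  finally have 1: "emeasure (\<mu> \<Otimes>\<^sub>M \<mu>) E = emeasure \<mu> A" .
  have "emeasure (\<mu> \<Otimes>\<^sub>M \<mu>) E = (\<integral>\<^sup>+g. emeasure \<mu> {x. - g + x \<in> {y. - y \<in> A}} \<partial>\<mu>)"
    unfolding H.emeasure_pair_measure_alt2[OF E] by (simp add: E_def vimage_def minus_add)
  also have "\<dots> = emeasure \<mu> {y. - y \<in> A}"
    by (simp add: emeasure_left refl emeasure_space_1[simplified] del: mem_Collect_eq)
  finally show ?thesis using 1 by simp
qed

text \<open>Conjugation by the reflection turns a right translation into a left one, and the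
  reflection preserves the measure of Baire sets.\<close>

lemma emeasure_right:
  assumes A: "A \<in> sets baire"
  shows "emeasure \<mu> {x. x + g \<in> A} = emeasure \<mu> A"
proof -
  have uminus: "continuous_on UNIV (\<lambda>x::'a. - x)" by (intro continuous_intros)
  have refl: "{x. - x \<in> A} \<in> sets borel"
    using measurable_sets[OF measurable_borel_baire[OF uminus] A] by (simp add: vimage_def)
  have "emeasure \<mu> {x. x + g \<in> A} = emeasure \<mu> {x. - x + g \<in> A}"
    using emeasure_reflect[OF right_vimage_baire[OF A]] by simp
  also have "\<dots> = emeasure \<mu> {x. - g + x \<in> {y. - y \<in> A}}"
    by (simp add: minus_add)
  also have "\<dots> = emeasure \<mu> A"
    using emeasure_left[OF refl] emeasure_reflect[OF A] by simp
  finally show ?thesis .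
qed

text \<open>Regularity gives a compact \<open>K\<close> and an open \<open>U\<close> around
  \<open>Y\<close> such that \<open>U - Y\<close> and \<open>U - K\<close> each have measure at most
  \<open>e / 2\<close>. A Urysohn function for \<open>K\<close> and \<open>U\<close> differs from
  the indicator only there, by at most 1.\<close>

lemma continuous_L1_approx:
  assumes Y [measurable]: "Y \<in> sets borel" and e: "0 < e"
  obtains \<phi> :: "'a \<Rightarrow> real" where "continuous_on UNIV \<phi>" "\<And>x. 0 \<le> \<phi> x" "\<And>x. \<phi> x \<le> 1"
    "(\<integral>x. \<bar>\<phi> x - indicator Y x\<bar> \<partial>\<mu>) \<le> e"
proof -
  have "emeasure \<mu> Y < ennreal (measure \<mu> Y + e / 2)"
    unfolding emeasure_eq_measure using e by (intro ennreal_lessI) (auto simp: add_nonneg_pos)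
  then have "(INF U\<in>{U. open U \<and> Y \<subseteq> U}. emeasure \<mu> U) < ennreal (measure \<mu> Y + e / 2)"
    using outer_regular[OF Y] by metis
  then obtain U where U: "open U" "Y \<subseteq> U" and "emeasure \<mu> U < ennreal (measure \<mu> Y + e / 2)"
    unfolding INF_less_iff by blast
  then have U_less: "measure \<mu> U < measure \<mu> Y + e / 2"
    by (simp add: emeasure_eq_measure ennreal_less_iff del: ennreal_plus)
  obtain K where K: "compact K" "K \<subseteq> U" "measure \<mu> U - e / 2 \<le> measure \<mu> K"
  proof (cases "measure \<mu> U \<le> e / 2")
    case True
    then show ?thesis using that[of "{}"] by simp
  next
    case False
    then have "ennreal (measure \<mu> U - e / 2) < emeasure \<mu> U"
      unfolding emeasure_eq_measure using e by (intro ennreal_lessI) auto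
    then have "ennreal (measure \<mu> U - e / 2) < (SUP K\<in>{K. compact K \<and> K \<subseteq> U}. emeasure \<mu> K)"
      using inner_regular_open[OF U(1)] by metis
    then obtain K where K: "compact K" "K \<subseteq> U" "ennreal (measure \<mu> U - e / 2) < emeasure \<mu> K"
      unfolding less_SUP_iff by blast
    then have "measure \<mu> U - e / 2 < measure \<mu> K"
      using False by (simp add: emeasure_eq_measure ennreal_less_iff)
    then show ?thesis using K by (intro that[of K]) auto
  qed
  have [measurable]: "U \<in> sets borel" "K \<in> sets borel"
    using U(1) K(1) by (auto intro: borel_compact)
  obtain \<phi> :: "'a \<Rightarrow> real" where \<phi>: "continuous_on UNIV \<phi>" "\<And>x. 0 \<le> \<phi> x" "\<And>x. \<phi> x \<le> 1"
    "\<And>x. x \<in> K \<Longrightarrow> \<phi> x = 1" "\<And>x. x \<notin> U \<Longrightarrow> \<phi> x = 0"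
    by (rule compact_Urysohn[OF compact_UNIV K(1) U(1) K(2)]) blast
  have [measurable]: "\<phi> \<in> borel_measurable borel"
    by (rule borel_measurable_continuous_onI) fact
  have "(\<integral>x. \<bar>\<phi> x - indicator Y x\<bar> \<partial>\<mu>) \<le> (\<integral>x. indicator (U - Y) x + indicator (U - K) x \<partial>\<mu>)"
  proof (rule integral_mono)
    show "integrable \<mu> (\<lambda>x. \<bar>\<phi> x - indicator Y x\<bar>)"
    proof (rule integrable_const_bound[of _ 1])
      show "AE x in \<mu>. norm \<bar>\<phi> x - indicator Y x\<bar> \<le> 1"
      proof (rule AE_I2)
        fix x show "norm \<bar>\<phi> x - indicator Y x\<bar> \<le> 1"
          using \<phi>(2,3)[of x] by (auto simp: indicator_def)
      qed
    qed measurable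
    show "\<bar>\<phi> x - indicator Y x\<bar> \<le> indicator (U - Y) x + indicator (U - K) x" for x
      using \<phi>(2-5)[of x] U(2) K(2) by (auto simp: indicator_def)
  qed (simp_all add: emeasure_eq_measure)
  also have "\<dots> = measure \<mu> (U - Y) + measure \<mu> (U - K)"
    by (simp add: emeasure_eq_measure)
  also have "\<dots> \<le> e"
    using U U_less K by (simp add: finite_measure_Diff)
  finally show ?thesis by (rule that[OF \<phi>(1-3)])
qed

text \<open>Replacing the indicator of \<open>Y\<close> by a continuous \<open>\<phi>\<close> yields
  a continuous function of \<open>g\<close>, by the tube lemma. By right invariance the error is
  bounded by the L1 distance from \<open>\<phi>\<close> to the indicator, whatever \<open>g\<close>
  is, so the limit is uniform.\<close>

lemma continuous_measure_Int_right_translate: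
  assumes Z [measurable]: "Z \<in> sets borel" and Y: "Y \<in> sets baire"
  shows "continuous_on UNIV (\<lambda>g. measure \<mu> (Z \<inter> {x. x + g \<in> Y}))"
proof (rule continuous_on_uniform_approx)
  fix e :: real assume "0 < e"
  obtain \<phi> :: "'a \<Rightarrow> real" where \<phi>: "continuous_on UNIV \<phi>" "\<And>x. 0 \<le> \<phi> x" "\<And>x. \<phi> x \<le> 1"
    "(\<integral>x. \<bar>\<phi> x - indicator Y x\<bar> \<partial>\<mu>) \<le> e"
    using continuous_L1_approx[OF baire_in_borel[OF Y] \<open>0 < e\<close>] by metis
  note Y[measurable]
  note continuous_on_baire_measurable[OF \<phi>(1), measurable]
  have [measurable]: "\<phi> \<in> borel_measurable borel" "Y \<in> sets borel"
    using baire_in_borel[OF Y] by (auto intro: borel_measurable_continuous_onI \<phi>(1))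
  have vimage [measurable]: "{x. x + g \<in> Y} \<in> sets borel" for g
    by (rule baire_in_borel[OF right_vimage_baire[OF Y]])
  define h where "h g = (\<integral>x. indicator Z x * \<phi> (x + g) \<partial>\<mu>)" for g
  have int: "integrable \<mu> (\<lambda>x. indicator Z x * \<phi> (x + g))" for g
    by (rule integrable_const_bound[of _ 1]) (use \<phi>(2,3) in \<open>auto simp: indicator_def\<close>)
  have cont: "continuous_on UNIV h"
    unfolding continuous_on_def
  proof (intro ballI tendstoI)
    fix g and d :: real assume "0 < d"
    have "continuous_on UNIV (\<lambda>p. \<phi> (snd p + fst p))"
      by (intro continuous_on_compose2[OF \<phi>(1)] continuous_intros) auto
    from continuous_on_prod_compact_nhd[OF compact_UNIV this, of "d / 2" g] \<open>0 < d\<close>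
    obtain X where X: "g \<in> X" "open X" "\<And>g' x. g' \<in> X \<Longrightarrow> \<bar>\<phi> (x + g') - \<phi> (x + g)\<bar> \<le> d / 2"
      by (auto simp: dist_real_def)
    have "dist (h g') (h g) < d" if "g' \<in> X" for g'
    proof -
      have "\<bar>h g' - h g\<bar> = \<bar>\<integral>x. indicator Z x * (\<phi> (x + g') - \<phi> (x + g)) \<partial>\<mu>\<bar>"
        using int by (simp add: h_def right_diff_distrib)
      also have "\<dots> \<le> (\<integral>x. \<bar>indicator Z x * (\<phi> (x + g') - \<phi> (x + g))\<bar> \<partial>\<mu>)"
        by (rule integral_abs_bound)
      also have "\<dots> \<le> (\<integral>x. d / 2 \<partial>\<mu>)"
      proof (rule integral_mono)
        show "integrable \<mu> (\<lambda>x. \<bar>indicator Z x * (\<phi> (x + g') - \<phi> (x + g))\<bar>)"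
          using int by (simp add: right_diff_distrib)
        show "\<bar>indicator Z x * (\<phi> (x + g') - \<phi> (x + g))\<bar> \<le> d / 2" for x
          using X(3)[OF that, of x] \<open>0 < d\<close> by (auto simp: indicator_def)
      qed simp
      also have "\<dots> = d / 2" by (simp add: prob_space[simplified])
      finally show ?thesis using \<open>0 < d\<close> by (simp add: dist_real_def)
    qed
    then show "\<forall>\<^sub>F g' in at g. dist (h g') (h g) < d"
      using X(1,2) unfolding eventually_at_topological by blast
  qed
  have close: "\<bar>h g - measure \<mu> (Z \<inter> {x. x + g \<in> Y})\<bar> \<le> e" for g
  proof -
    \<comment> \<open>Right invariance has been obtained for Baire sets, so the change of variables
      is carried out in \<open>\<beta>\<close>.\<close>
    have distr: "distr \<mu> baire (\<lambda>x. x + g) = \<beta>"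
    proof (rule measure_eqI)
      fix A assume "A \<in> sets (distr \<mu> baire (\<lambda>x. x + g))"
      then have A: "A \<in> sets baire" by simp
      have "(\<lambda>x. x + g) \<in> measurable \<mu> baire"
        using measurable_borel_baire[OF continuous_on_right[of g]] by simp
      then show "emeasure (distr \<mu> baire (\<lambda>x. x + g)) A = emeasure \<beta> A"
        using A emeasure_right[OF A, of g] by (simp add: emeasure_distr emeasure_\<beta> vimage_def)
    qed simp
    have rb [measurable]: "(\<lambda>x. x + g) \<in> measurable \<mu> baire"
      using measurable_borel_baire[OF continuous_on_right[of g]] by simp
    have "measure \<mu> (Z \<inter> {x. x + g \<in> Y}) = (\<integral>x. indicator (Z \<inter> {x. x + g \<in> Y}) x \<partial>\<mu>)"
      by simp
    also have "\<dots> = (\<integral>x. indicator Z x * indicator Y (x + g) \<partial>\<mu>)"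
      by (intro Bochner_Integration.integral_cong) (auto simp: indicator_def)
    finally have meq: "measure \<mu> (Z \<inter> {x. x + g \<in> Y}) = (\<integral>x. indicator Z x * indicator Y (x + g) \<partial>\<mu>)" .
    have int2: "integrable \<mu> (\<lambda>x. indicator Z x * indicator Y (x + g) :: real)"
      by (rule integrable_const_bound[of _ 1]) (auto simp: indicator_def)
    have int3: "integrable \<mu> (\<lambda>x. \<bar>\<phi> (x + g) - indicator Y (x + g)\<bar>)"
    proof (rule integrable_const_bound[of _ 1])
      show "AE x in \<mu>. norm \<bar>\<phi> (x + g) - indicator Y (x + g)\<bar> \<le> 1"
      proof (rule AE_I2)
        fix x show "norm \<bar>\<phi> (x + g) - indicator Y (x + g)\<bar> \<le> 1"
          using \<phi>(2,3)[of "x + g"] by (auto simp: indicator_def)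
      qed
    qed measurable
    have "\<bar>h g - measure \<mu> (Z \<inter> {x. x + g \<in> Y})\<bar> = \<bar>\<integral>x. indicator Z x * (\<phi> (x + g) - indicator Y (x + g)) \<partial>\<mu>\<bar>"
      using int[of g] int2 by (simp add: h_def meq right_diff_distrib)
    also have "\<dots> \<le> (\<integral>x. \<bar>indicator Z x * (\<phi> (x + g) - indicator Y (x + g))\<bar> \<partial>\<mu>)"
      by (rule integral_abs_bound)
    also have "\<dots> \<le> (\<integral>x. \<bar>\<phi> (x + g) - indicator Y (x + g)\<bar> \<partial>\<mu>)"
    proof (rule integral_mono)
      show "integrable \<mu> (\<lambda>x. \<bar>indicator Z x * (\<phi> (x + g) - indicator Y (x + g))\<bar>)"
        using int int2 by (simp add: right_diff_distrib)
      show "\<bar>indicator Z x * (\<phi> (x + g) - indicator Y (x + g))\<bar> \<le> \<bar>\<phi> (x + g) - indicator Y (x + g)\<bar>" for x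
        by (auto simp: indicator_def)
    qed (rule int3)
    also have "\<dots> = (\<integral>x. \<bar>\<phi> x - indicator Y x\<bar> \<partial>\<beta>)"
      unfolding distr[symmetric] by (rule integral_distr[symmetric, OF rb]) measurable
    also have "\<dots> = (\<integral>x. \<bar>\<phi> x - indicator Y x\<bar> \<partial>\<mu>)"
      unfolding \<beta>_def by (rule integral_distr) measurable
    finally show ?thesis using \<phi>(4) by simp
  qed
  show "\<exists>h. continuous_on UNIV h \<and> (\<forall>g. \<bar>h g - measure \<mu> (Z \<inter> {x. x + g \<in> Y})\<bar> \<le> e)"
    using cont close by blast
qed

text \<open>Fubini for the pairs \<open>(g, x)\<close> with \<open>x \<in> Z\<close> and
  \<open>x + g \<in> Y\<close>: for fixed \<open>x \<in> Z\<close>, the admissible \<open>g\<close>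
  form a left translate of \<open>Y\<close>.\<close>

lemma integral_measure_Int_right_translate:
  assumes Z [measurable]: "Z \<in> sets borel" and Y: "Y \<in> sets baire"
  shows "(\<integral>g. measure \<mu> (Z \<inter> {x. x + g \<in> Y}) \<partial>\<mu>) = measure \<mu> Z * measure \<mu> Y"
    "integrable \<mu> (\<lambda>g. measure \<mu> (Z \<inter> {x. x + g \<in> Y}))"
proof -
  note Y[measurable]
  interpret H: pair_prob_space \<mu> \<mu> ..
  define E where "E = {p. snd p \<in> Z \<and> snd p + fst p \<in> Y}"
  have E: "E \<in> sets (\<mu> \<Otimes>\<^sub>M \<mu>)"
  proof -
    have "{p \<in> space (\<mu> \<Otimes>\<^sub>M \<mu>). snd p \<in> Z \<and> snd p + fst p \<in> Y} \<in> sets (\<mu> \<Otimes>\<^sub>M \<mu>)" by measurable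
    then show ?thesis by (simp add: E_def space_pair_measure)
  qed
  have "emeasure (\<mu> \<Otimes>\<^sub>M \<mu>) E = (\<integral>\<^sup>+g. emeasure \<mu> (Z \<inter> {x. x + g \<in> Y}) \<partial>\<mu>)"
    unfolding emeasure_pair_measure_alt[OF E] by (simp add: E_def vimage_def Int_def)
  moreover have "emeasure (\<mu> \<Otimes>\<^sub>M \<mu>) E = (\<integral>\<^sup>+x. emeasure \<mu> {g. x \<in> Z \<and> x + g \<in> Y} \<partial>\<mu>)"
    unfolding H.emeasure_pair_measure_alt2[OF E] by (simp add: E_def vimage_def)
  moreover have "\<dots> = (\<integral>\<^sup>+x. emeasure \<mu> Y * indicator Z x \<partial>\<mu>)"
    by (intro nn_integral_cong) (auto simp: indicator_def emeasure_left_baire Y)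
  moreover have "\<dots> = emeasure \<mu> Y * emeasure \<mu> Z"
    by (simp add: nn_integral_cmult)
  ultimately have nn: "(\<integral>\<^sup>+g. ennreal (measure \<mu> (Z \<inter> {x. x + g \<in> Y})) \<partial>\<mu>) = ennreal (measure \<mu> Z * measure \<mu> Y)"
    by (simp add: emeasure_eq_measure ennreal_mult mult.commute)
  have meas: "(\<lambda>g. measure \<mu> (Z \<inter> {x. x + g \<in> Y})) \<in> borel_measurable \<mu>"
    using borel_measurable_continuous_onI[OF continuous_measure_Int_right_translate[OF Z Y]] by simp
  show int: "integrable \<mu> (\<lambda>g. measure \<mu> (Z \<inter> {x. x + g \<in> Y}))"
    by (rule integrable_const_bound[of _ 1]) (use meas in auto)
  have "ennreal (\<integral>g. measure \<mu> (Z \<inter> {x. x + g \<in> Y}) \<partial>\<mu>) = ennreal (measure \<mu> Z * measure \<mu> Y)"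
    using nn_integral_eq_integral[OF int] nn by simp
  then show "(\<integral>g. measure \<mu> (Z \<inter> {x. x + g \<in> Y}) \<partial>\<mu>) = measure \<mu> Z * measure \<mu> Y"
    by (subst (asm) ennreal_inj) auto
qed

text \<open>A continuous function with mean \<open>c\<close> takes values on both sides of
  \<open>c\<close>; on a connected group it therefore takes the value \<open>c\<close>.\<close>

lemma exists_independent_right_translate:
  assumes conn: "connected (UNIV :: 'a set)" and Z: "Z \<in> sets borel" and Y: "Y \<in> sets baire"
  obtains g where "measure \<mu> (Z \<inter> {x. x + g \<in> Y}) = measure \<mu> Z * measure \<mu> Y"
proof -
  define c where "c = measure \<mu> Z * measure \<mu> Y"
  define F where "F g = measure \<mu> (Z \<inter> {x. x + g \<in> Y})" for g
  have F: "continuous_on UNIV F" "integrable \<mu> F" "(\<integral>g. F g \<partial>\<mu>) = c"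
    using continuous_measure_Int_right_translate[OF Z Y] integral_measure_Int_right_translate[OF Z Y]
    by (simp_all add: F_def[abs_def] c_def)
  have "\<exists>g. F g \<le> c"
  proof (rule ccontr)
    assume "\<nexists>g. F g \<le> c"
    then have "AE g in \<mu>. c < F g" by (simp add: not_le)
    then show False using expectation_greater[OF F(2), of c] F(3) by simp
  qed
  moreover have "\<exists>g. c \<le> F g"
  proof (rule ccontr)
    assume "\<nexists>g. c \<le> F g"
    then have "AE g in \<mu>. F g < c" by (simp add: not_le)
    then show False using expectation_less[OF F(2), of c] F(3) by simp
  qed
  ultimately obtain g1 g2 where g: "F g1 \<le> c" "c \<le> F g2" by auto
  have "{F g1..F g2} \<subseteq> range F"
    using connected_continuous_image[OF F(1) conn] by (intro connected_contains_Icc) auto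
  then obtain g where "F g = c" using g by auto
  then show ?thesis by (intro that[of g]) (simp add: F_def c_def)
qed

end

subsection \<open>The averaging operator\<close>

text \<open>Domination on Borel sets passes to the measures of product sets by integrating the
  measures of their sections.\<close>

lemma pair_measure_dominated:
  fixes \<mu> \<nu> \<nu>1 :: "'a::topological_space measure"
  assumes "prob_space \<mu>" "prob_space \<nu>" "prob_space \<nu>1"
    and sets: "sets \<nu> = sets borel" "sets \<nu>1 = sets borel"
    and \<kappa>: "0 \<le> \<kappa>" "\<And>A. A \<in> sets borel \<Longrightarrow> \<kappa> * measure \<nu>1 A \<le> measure \<nu> A"
    and E: "E \<in> sets (borel \<Otimes>\<^sub>M \<mu>)"
  shows "\<kappa> * measure (\<nu>1 \<Otimes>\<^sub>M \<mu>) E \<le> measure (\<nu> \<Otimes>\<^sub>M \<mu>) E"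
proof -
  interpret \<mu>: prob_space \<mu> by fact
  interpret \<nu>: prob_space \<nu> by fact
  interpret \<nu>1: prob_space \<nu>1 by fact
  interpret P: pair_prob_space \<nu> \<mu> ..
  interpret P1: pair_prob_space \<nu>1 \<mu> ..
  have E1: "E \<in> sets (\<nu>1 \<Otimes>\<^sub>M \<mu>)" and E2: "E \<in> sets (\<nu> \<Otimes>\<^sub>M \<mu>)"
    using E sets_pair_measure_cong[OF sets(1) refl, of \<mu>] sets_pair_measure_cong[OF sets(2) refl, of \<mu>] by auto
  define w where "w a = emeasure \<mu> (Pair a -` E)" for a
  have w: "w \<in> borel_measurable \<nu>1"
    unfolding w_def[abs_def] by (rule \<mu>.measurable_emeasure_Pair[OF E1])
  \<comment> \<open>The order on measures compares spaces first, then sigma algebras, then values.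
    The first two agree here, so the comparison is setwise.\<close>
  have "scale_measure (ennreal \<kappa>) \<nu>1 \<le> \<nu>"
  proof (rule less_eq_measure.intros(3)[of _ _])
    show "space (scale_measure (ennreal \<kappa>) \<nu>1) = space \<nu>"
      using sets_eq_imp_space_eq[OF sets(1)] sets_eq_imp_space_eq[OF sets(2)] by (simp add: space_scale_measure)
    show "sets (scale_measure (ennreal \<kappa>) \<nu>1) = sets \<nu>" using sets by simp
    show "emeasure (scale_measure (ennreal \<kappa>) \<nu>1) \<le> emeasure \<nu>"
    proof (rule le_funI)
      fix A
      show "emeasure (scale_measure (ennreal \<kappa>) \<nu>1) A \<le> emeasure \<nu> A"
      proof (cases "A \<in> sets borel")
        case True
        then show ?thesis
          using \<kappa> by (simp add: \<nu>.emeasure_eq_measure \<nu>1.emeasure_eq_measure ennreal_mult[symmetric])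
      qed (simp add: emeasure_notin_sets sets)
    qed
  qed
  then have "(\<integral>\<^sup>+a. w a \<partial>scale_measure (ennreal \<kappa>) \<nu>1) \<le> (\<integral>\<^sup>+a. w a \<partial>\<nu>)"
    by (rule nn_integral_mono_measure[rotated]) (simp add: sets)
  then have "ennreal \<kappa> * (\<integral>\<^sup>+a. w a \<partial>\<nu>1) \<le> (\<integral>\<^sup>+a. w a \<partial>\<nu>)"
    using nn_integral_scale_measure[OF w] by simp
  then have "ennreal \<kappa> * emeasure (\<nu>1 \<Otimes>\<^sub>M \<mu>) E \<le> emeasure (\<nu> \<Otimes>\<^sub>M \<mu>) E"
    by (simp add: w_def \<mu>.emeasure_pair_measure_alt[OF E1] \<mu>.emeasure_pair_measure_alt[OF E2])
  then show ?thesis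
    using \<kappa>(1) by (simp add: P.emeasure_eq_measure P1.emeasure_eq_measure ennreal_mult[symmetric])
qed

locale compact_haar_walk = compact_haar \<mu> for \<mu> :: "'a::{topological_group_add, t2_space} measure" +
  fixes \<nu> :: "'a measure"
  assumes \<nu>: "borel_prob \<nu>"
begin

lemma sets_\<nu> [measurable_cong, simp]: "sets \<nu> = sets borel"
  using \<nu> by (simp add: borel_prob_def)

lemma space_\<nu> [simp]: "space \<nu> = UNIV"
  using sets_eq_imp_space_eq[OF sets_\<nu>] by simp

sublocale \<nu>: prob_space \<nu>
  using \<nu> by (simp add: borel_prob_def)

sublocale P: pair_prob_space \<nu> \<mu> ..

text \<open>A pair \<open>p\<close> is read as a random step from \<open>snd p\<close> to
  \<open>fst p + snd p\<close>. Left invariance on each section makes the endpoint Haar distributed,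
  as the starting point is; this is the equality in law used by the Cheeger inequality.\<close>

lemma distr_plus: "distr (\<nu> \<Otimes>\<^sub>M \<mu>) baire (\<lambda>p. fst p + snd p) = \<beta>"
proof (rule measure_eqI)
  fix A assume "A \<in> sets (distr (\<nu> \<Otimes>\<^sub>M \<mu>) baire (\<lambda>p. fst p + snd p :: 'a))"
  then have A [measurable]: "A \<in> sets baire" by simp
  have "emeasure (distr (\<nu> \<Otimes>\<^sub>M \<mu>) baire (\<lambda>p. fst p + snd p)) A = emeasure (\<nu> \<Otimes>\<^sub>M \<mu>) ((\<lambda>p. fst p + snd p) -` A \<inter> space (\<nu> \<Otimes>\<^sub>M \<mu>))"
    by (rule emeasure_distr) simp_all
  also have "\<dots> = (\<integral>\<^sup>+a. emeasure \<mu> (Pair a -` ((\<lambda>p. fst p + snd p) -` A \<inter> space (\<nu> \<Otimes>\<^sub>M \<mu>))) \<partial>\<nu>)"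
    by (rule emeasure_pair_measure_alt) (rule measurable_sets[OF _ A], simp)
  also have "\<dots> = (\<integral>\<^sup>+a. emeasure \<mu> {x. a + x \<in> A} \<partial>\<nu>)"
    by (intro nn_integral_cong arg_cong[where f="emeasure \<mu>"]) (auto simp: space_pair_measure)
  finally show "emeasure (distr (\<nu> \<Otimes>\<^sub>M \<mu>) baire (\<lambda>p. fst p + snd p)) A = emeasure \<beta> A"
    by (simp add: emeasure_left_baire emeasure_\<beta> \<nu>.emeasure_space_1[simplified])
qed simp

lemma distr_snd: "distr (\<nu> \<Otimes>\<^sub>M \<mu>) baire snd = \<beta>"
proof (rule measure_eqI)
  fix A assume "A \<in> sets (distr (\<nu> \<Otimes>\<^sub>M \<mu>) baire (snd :: 'a \<times> 'a \<Rightarrow> 'a))"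
  then have A [measurable]: "A \<in> sets baire" by simp
  have "emeasure (distr (\<nu> \<Otimes>\<^sub>M \<mu>) baire snd) A = emeasure (\<nu> \<Otimes>\<^sub>M \<mu>) (snd -` A \<inter> space (\<nu> \<Otimes>\<^sub>M \<mu>))"
    by (rule emeasure_distr) simp_all
  also have "snd -` A \<inter> space (\<nu> \<Otimes>\<^sub>M \<mu>) = UNIV \<times> A" by (auto simp: space_pair_measure)
  also have "emeasure (\<nu> \<Otimes>\<^sub>M \<mu>) (UNIV \<times> A) = emeasure \<mu> A"
    using emeasure_pair_measure_Times[of UNIV \<nu> A] baire_in_borel[OF A] \<nu>.emeasure_space_1 by simp
  finally show "emeasure (distr (\<nu> \<Otimes>\<^sub>M \<mu>) baire snd) A = emeasure \<beta> A"
    by (simp add: emeasure_\<beta>)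
qed simp

lemma integral_plus:
  fixes u :: "'a \<Rightarrow> real"
  assumes [measurable]: "u \<in> borel_measurable baire"
  shows "integrable (\<nu> \<Otimes>\<^sub>M \<mu>) (\<lambda>p. u (fst p + snd p)) \<longleftrightarrow> integrable \<mu> u"
    "(\<integral>p. u (fst p + snd p) \<partial>(\<nu> \<Otimes>\<^sub>M \<mu>)) = (\<integral>x. u x \<partial>\<mu>)"
    "integrable (\<nu> \<Otimes>\<^sub>M \<mu>) (\<lambda>p. u (snd p)) \<longleftrightarrow> integrable \<mu> u"
    "(\<integral>p. u (snd p) \<partial>(\<nu> \<Otimes>\<^sub>M \<mu>)) = (\<integral>x. u x \<partial>\<mu>)"
proof -
  have \<beta>: "integrable \<beta> u \<longleftrightarrow> integrable \<mu> u" "(\<integral>x. u x \<partial>\<beta>) = (\<integral>x. u x \<partial>\<mu>)"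
    unfolding \<beta>_def by (simp_all add: integrable_distr_eq integral_distr)
  show "integrable (\<nu> \<Otimes>\<^sub>M \<mu>) (\<lambda>p. u (fst p + snd p)) \<longleftrightarrow> integrable \<mu> u"
    using integrable_distr_eq[of "\<lambda>p. fst p + snd p" "\<nu> \<Otimes>\<^sub>M \<mu>" baire u] \<beta> by (simp add: distr_plus)
  show "(\<integral>p. u (fst p + snd p) \<partial>(\<nu> \<Otimes>\<^sub>M \<mu>)) = (\<integral>x. u x \<partial>\<mu>)"
    using integral_distr[of "\<lambda>p. fst p + snd p" "\<nu> \<Otimes>\<^sub>M \<mu>" baire u] \<beta> by (simp add: distr_plus)
  show "integrable (\<nu> \<Otimes>\<^sub>M \<mu>) (\<lambda>p. u (snd p)) \<longleftrightarrow> integrable \<mu> u"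
    using integrable_distr_eq[of snd "\<nu> \<Otimes>\<^sub>M \<mu>" baire u] \<beta> by (simp add: distr_snd)
  show "(\<integral>p. u (snd p) \<partial>(\<nu> \<Otimes>\<^sub>M \<mu>)) = (\<integral>x. u x \<partial>\<mu>)"
    using integral_distr[of snd "\<nu> \<Otimes>\<^sub>M \<mu>" baire u] \<beta> by (simp add: distr_snd)
qed

text \<open>For each fixed \<open>a\<close> the exceptional \<open>x\<close> form a null translate
  of \<open>N\<close>. The quantifiers may be exchanged because, \<open>N\<close> being Baire, the
  event is measurable in the product.\<close>

lemma AE_AE_translate_notin:
  assumes N [measurable]: "N \<in> sets baire" and null: "emeasure \<mu> N = 0"
  shows "AE x in \<mu>. AE a in \<nu>. a + x \<notin> N"
proof -
  have "AE a in \<nu>. AE x in \<mu>. a + x \<notin> N"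
  proof (rule AE_I2)
    fix a
    show "AE x in \<mu>. a + x \<notin> N"
      using null baire_in_borel[OF left_vimage_baire[OF N]]
      by (intro AE_I[of _ _ "{x. a + x \<in> N}"]) (auto simp: emeasure_left_baire)
  qed
  moreover have "{p \<in> space (\<nu> \<Otimes>\<^sub>M \<mu>). fst p + snd p \<notin> N} \<in> sets (\<nu> \<Otimes>\<^sub>M \<mu>)"
    by measurable
  ultimately show ?thesis using P.AE_commute[of "\<lambda>a x. a + x \<notin> N"] by simp
qed

text \<open>Both ends of a step have the same law, so
  \<open>u * v \<le> (u\<^sup>2 + v\<^sup>2) / 2\<close> integrates to the last claim, which bounds
  Rayleigh quotients by 1.\<close>

lemma integrable_shift_mult:
  fixes f :: "'a \<Rightarrow> real"
  assumes [measurable]: "f \<in> borel_measurable baire" and f2: "integrable \<mu> (\<lambda>x. (f x)\<^sup>2)"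
  shows "integrable (\<nu> \<Otimes>\<^sub>M \<mu>) (\<lambda>p. f (fst p + snd p) * f (snd p))"
    "integrable (\<nu> \<Otimes>\<^sub>M \<mu>) (\<lambda>p. (f (fst p + snd p))\<^sup>2)"
    "integrable (\<nu> \<Otimes>\<^sub>M \<mu>) (\<lambda>p. (f (snd p))\<^sup>2)"
    "(\<integral>p. (f (fst p + snd p))\<^sup>2 \<partial>(\<nu> \<Otimes>\<^sub>M \<mu>)) = (\<integral>x. (f x)\<^sup>2 \<partial>\<mu>)"
    "(\<integral>p. (f (snd p))\<^sup>2 \<partial>(\<nu> \<Otimes>\<^sub>M \<mu>)) = (\<integral>x. (f x)\<^sup>2 \<partial>\<mu>)"
    "(\<integral>p. f (fst p + snd p) * f (snd p) \<partial>(\<nu> \<Otimes>\<^sub>M \<mu>)) \<le> (\<integral>x. (f x)\<^sup>2 \<partial>\<mu>)"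
proof -
  show 1: "integrable (\<nu> \<Otimes>\<^sub>M \<mu>) (\<lambda>p. (f (fst p + snd p))\<^sup>2)"
    "integrable (\<nu> \<Otimes>\<^sub>M \<mu>) (\<lambda>p. (f (snd p))\<^sup>2)"
    using integral_plus[of "\<lambda>x. (f x)\<^sup>2"] f2 by simp_all
  show 2: "(\<integral>p. (f (fst p + snd p))\<^sup>2 \<partial>(\<nu> \<Otimes>\<^sub>M \<mu>)) = (\<integral>x. (f x)\<^sup>2 \<partial>\<mu>)"
    "(\<integral>p. (f (snd p))\<^sup>2 \<partial>(\<nu> \<Otimes>\<^sub>M \<mu>)) = (\<integral>x. (f x)\<^sup>2 \<partial>\<mu>)"
    using integral_plus[of "\<lambda>x. (f x)\<^sup>2"] by simp_all
  have ineq: "\<bar>u * v\<bar> \<le> (u\<^sup>2 + v\<^sup>2) / 2" for u v :: real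
    using sum_squares_bound[of "\<bar>u\<bar>" "\<bar>v\<bar>"] by (simp add: abs_mult)
  show 3: "integrable (\<nu> \<Otimes>\<^sub>M \<mu>) (\<lambda>p. f (fst p + snd p) * f (snd p))"
    by (rule Bochner_Integration.integrable_bound[of _ "\<lambda>p. ((f (fst p + snd p))\<^sup>2 + (f (snd p))\<^sup>2) / 2"])
       (use 1 ineq in auto)
  have "(\<integral>p. f (fst p + snd p) * f (snd p) \<partial>(\<nu> \<Otimes>\<^sub>M \<mu>)) \<le> (\<integral>p. ((f (fst p + snd p))\<^sup>2 + (f (snd p))\<^sup>2) / 2 \<partial>(\<nu> \<Otimes>\<^sub>M \<mu>))"
    using 1 3 by (intro integral_mono) (auto intro: order_trans[OF abs_ge_self ineq, simplified])
  also have "\<dots> = (\<integral>x. (f x)\<^sup>2 \<partial>\<mu>)" using 1 2 by simp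
  finally show "(\<integral>p. f (fst p + snd p) * f (snd p) \<partial>(\<nu> \<Otimes>\<^sub>M \<mu>)) \<le> (\<integral>x. (f x)\<^sup>2 \<partial>\<mu>)" .
qed

text \<open>For almost every \<open>x\<close>, the functions \<open>f\<close> and \<open>f'\<close>
  agree at \<open>a + x\<close> for almost every \<open>a\<close>, so their averages agree almost
  everywhere. The quadratic form can thus be computed with \<open>f'\<close>, for which Fubini is
  available.\<close>

lemma L2_inner_averaging:
  fixes f f' :: "'a \<Rightarrow> real"
  assumes f: "f \<in> borel_measurable borel" and f2: "integrable \<mu> (\<lambda>x. (f x)\<^sup>2)"
    and f' [measurable]: "f' \<in> borel_measurable baire" and N: "N \<in> sets baire" "emeasure \<mu> N = 0"
    and eq: "\<And>x. x \<notin> N \<Longrightarrow> f x = f' x"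
  shows "integrable \<mu> (\<lambda>x. (f' x)\<^sup>2)" "(\<integral>x. f x \<partial>\<mu>) = (\<integral>x. f' x \<partial>\<mu>)"
    "L2_inner \<mu> f f = (\<integral>x. (f' x)\<^sup>2 \<partial>\<mu>)"
    "L2_inner \<mu> (averaging \<nu> f) f = (\<integral>p. f' (fst p + snd p) * f' (snd p) \<partial>(\<nu> \<Otimes>\<^sub>M \<mu>))"
proof -
  have [measurable]: "f' \<in> borel_measurable borel"
    using measurable_compose[OF measurable_id_baire f'] .
  note f[measurable]
  have AE: "AE x in \<mu>. f x = f' x"
    using N baire_in_borel[OF N(1)] eq by (intro AE_I[of _ _ N]) auto
  show f'2: "integrable \<mu> (\<lambda>x. (f' x)\<^sup>2)"
    using AE by (intro integrable_cong_AE_imp[OF f2]) auto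
  show "(\<integral>x. f x \<partial>\<mu>) = (\<integral>x. f' x \<partial>\<mu>)"
    using AE by (intro integral_cong_AE) auto
  have "L2_inner \<mu> f f = (\<integral>x. f x * f x \<partial>\<mu>)"
    unfolding L2_inner_def by (rule integral_completion) simp
  also have "\<dots> = (\<integral>x. (f' x)\<^sup>2 \<partial>\<mu>)"
    using AE by (intro integral_cong_AE) (auto simp: power2_eq_square)
  finally show "L2_inner \<mu> f f = (\<integral>x. (f' x)\<^sup>2 \<partial>\<mu>)" .
  have AE2: "AE x in \<mu>. averaging \<nu> f x = averaging \<nu> f' x"
    using AE_AE_translate_notin[OF N]
  proof eventually_elim
    case (elim x)
    show ?case unfolding averaging_def
    proof (rule integral_cong_AE)
      show "(\<lambda>a. f (a + x)) \<in> borel_measurable \<nu>" "(\<lambda>a. f' (a + x)) \<in> borel_measurable \<nu>"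
        by measurable
      show "AE a in \<nu>. f (a + x) = f' (a + x)"
        using elim by eventually_elim (rule eq)
    qed
  qed
  \<comment> \<open>The variable integrated out must come second in the pair, hence the sum in
    swapped order.\<close>
  have av [measurable]: "averaging \<nu> f' \<in> borel_measurable \<mu>"
    unfolding averaging_def[abs_def]
  proof (rule \<nu>.borel_measurable_lebesgue_integral)
    have "(\<lambda>p. f' (snd p + fst p)) \<in> borel_measurable (\<mu> \<Otimes>\<^sub>M \<nu>)" by measurable
    then show "(\<lambda>(x, a). f' (a + x)) \<in> borel_measurable (\<mu> \<Otimes>\<^sub>M \<nu>)" by (simp add: case_prod_beta')
  qed
  have prod_AE: "AE x in \<mu>. averaging \<nu> f x * f x = averaging \<nu> f' x * f' x"
    using AE AE2 by eventually_elim simp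
  have prod': "(\<lambda>x. averaging \<nu> f' x * f' x) \<in> borel_measurable \<mu>" by measurable
  have "L2_inner \<mu> (averaging \<nu> f) f = (\<integral>x. averaging \<nu> f' x * f' x \<partial>completion \<mu>)"
    unfolding L2_inner_def
    by (rule integral_cong_AE[OF borel_measurable_completion_AE_eq[OF prod' prod_AE] measurable_completion[OF prod'] AE_completion[OF prod_AE]])
  also have "\<dots> = (\<integral>x. averaging \<nu> f' x * f' x \<partial>\<mu>)"
    by (rule integral_completion) measurable
  also have "\<dots> = (\<integral>x. (\<integral>a. f' (a + x) * f' x \<partial>\<nu>) \<partial>\<mu>)"
    by (simp add: averaging_def)
  also have "\<dots> = (\<integral>p. f' (fst p + snd p) * f' (snd p) \<partial>(\<nu> \<Otimes>\<^sub>M \<mu>))"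
    using P.integral_snd[of "\<lambda>a x. f' (a + x) * f' x"] integrable_shift_mult(1)[OF f' f'2]
    by (simp add: case_prod_beta')
  finally show "L2_inner \<mu> (averaging \<nu> f) f = (\<integral>p. f' (fst p + snd p) * f' (snd p) \<partial>(\<nu> \<Otimes>\<^sub>M \<mu>))" .
qed

text \<open>A real supremum dominates its members only if the set is bounded above; here 1 is a
  bound.\<close>

lemma rho_plus_upper:
  assumes "f \<in> L2_0 \<mu>" "\<not> (AE x in \<mu>. f x = 0)"
  shows "L2_inner \<mu> (averaging \<nu> f) f / L2_inner \<mu> f f \<le> rho_plus \<mu> \<nu>"
  unfolding rho_plus_def
proof (rule cSUP_upper)
  show "bdd_above ((\<lambda>f. L2_inner \<mu> (averaging \<nu> f) f / L2_inner \<mu> f f) ` {f \<in> L2_0 \<mu>. \<not> (AE x in \<mu>. f x = 0)})"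
  proof (rule bdd_aboveI2)
    fix f assume "f \<in> {f \<in> L2_0 \<mu>. \<not> (AE x in \<mu>. f x = 0)}"
    then have f: "f \<in> borel_measurable borel" "integrable \<mu> (\<lambda>x. (f x)\<^sup>2)"
      by (auto simp: L2_0_def L2_def)
    obtain f' N where f': "f' \<in> borel_measurable baire" "N \<in> sets baire" "emeasure \<mu> N = 0" "\<And>x. x \<notin> N \<Longrightarrow> f x = f' x"
      using baire_version[OF f(1)] by blast
    note * = L2_inner_averaging[OF f f']
    show "L2_inner \<mu> (averaging \<nu> f) f / L2_inner \<mu> f f \<le> 1"
      using integrable_shift_mult(6)[OF f'(1) *(1)]
      \<comment> \<open>Division by 0 yields 0, which settles the case of zero norm.\<close>
      by (cases "(\<integral>x. (f' x)\<^sup>2 \<partial>\<mu>) = 0") (simp_all add: * divide_le_eq_1 less_le)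
  qed
qed (use assms in simp)

subsection \<open>Boundaries of sets\<close>

text \<open>The probability that a random step enters \<open>Y\<close>. Only entries are counted;
  \<open>bdry_Compl\<close> shows that exits are equally likely.\<close>

definition bdry :: "'a set \<Rightarrow> real" where
  "bdry Y = measure (\<nu> \<Otimes>\<^sub>M \<mu>) {p. fst p + snd p \<in> Y \<and> snd p \<notin> Y}"

lemma space_P [simp]: "space (\<nu> \<Otimes>\<^sub>M \<mu>) = UNIV"
  by (simp add: space_pair_measure)

lemma walk_events:
  assumes [measurable]: "A \<in> sets baire" "B \<in> sets baire"
  shows "{p. fst p + snd p \<in> A \<and> snd p \<in> B} \<in> sets (\<nu> \<Otimes>\<^sub>M \<mu>)"
    "{p. fst p + snd p \<in> A \<and> snd p \<notin> B} \<in> sets (\<nu> \<Otimes>\<^sub>M \<mu>)"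
    "{p. fst p + snd p \<in> A} \<in> sets (\<nu> \<Otimes>\<^sub>M \<mu>)"
    "{p. snd p \<in> B} \<in> sets (\<nu> \<Otimes>\<^sub>M \<mu>)"
proof -
  have "{p \<in> space (\<nu> \<Otimes>\<^sub>M \<mu>). fst p + snd p \<in> A \<and> snd p \<in> B} \<in> sets (\<nu> \<Otimes>\<^sub>M \<mu>)"
    "{p \<in> space (\<nu> \<Otimes>\<^sub>M \<mu>). fst p + snd p \<in> A \<and> snd p \<notin> B} \<in> sets (\<nu> \<Otimes>\<^sub>M \<mu>)"
    "{p \<in> space (\<nu> \<Otimes>\<^sub>M \<mu>). fst p + snd p \<in> A} \<in> sets (\<nu> \<Otimes>\<^sub>M \<mu>)"
    "{p \<in> space (\<nu> \<Otimes>\<^sub>M \<mu>). snd p \<in> B} \<in> sets (\<nu> \<Otimes>\<^sub>M \<mu>)"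
    by measurable
  then show "{p. fst p + snd p \<in> A \<and> snd p \<in> B} \<in> sets (\<nu> \<Otimes>\<^sub>M \<mu>)"
    "{p. fst p + snd p \<in> A \<and> snd p \<notin> B} \<in> sets (\<nu> \<Otimes>\<^sub>M \<mu>)"
    "{p. fst p + snd p \<in> A} \<in> sets (\<nu> \<Otimes>\<^sub>M \<mu>)"
    "{p. snd p \<in> B} \<in> sets (\<nu> \<Otimes>\<^sub>M \<mu>)"
    by simp_all
qed

lemma measure_P:
  assumes A: "A \<in> sets baire"
  shows "measure (\<nu> \<Otimes>\<^sub>M \<mu>) {p. fst p + snd p \<in> A} = measure \<mu> A"
    "measure (\<nu> \<Otimes>\<^sub>M \<mu>) {p. snd p \<in> A} = measure \<mu> A"
proof -
  have \<beta>: "measure \<beta> A = measure \<mu> A" by (simp add: measure_def emeasure_\<beta> A)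
  have "measure (distr (\<nu> \<Otimes>\<^sub>M \<mu>) baire (\<lambda>p. fst p + snd p)) A = measure (\<nu> \<Otimes>\<^sub>M \<mu>) {p. fst p + snd p \<in> A}"
    by (subst measure_distr) (use A in \<open>simp_all add: vimage_def\<close>)
  then show "measure (\<nu> \<Otimes>\<^sub>M \<mu>) {p. fst p + snd p \<in> A} = measure \<mu> A"
    by (simp add: distr_plus \<beta>)
  have "measure (distr (\<nu> \<Otimes>\<^sub>M \<mu>) baire snd) A = measure (\<nu> \<Otimes>\<^sub>M \<mu>) {p. snd p \<in> A}"
    by (subst measure_distr) (use A in \<open>simp_all add: vimage_def\<close>)
  then show "measure (\<nu> \<Otimes>\<^sub>M \<mu>) {p. snd p \<in> A} = measure \<mu> A"
    by (simp add: distr_snd \<beta>)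
qed

lemma measure_P_stay:
  assumes A: "A \<in> sets baire"
  shows "measure (\<nu> \<Otimes>\<^sub>M \<mu>) {p. fst p + snd p \<in> A \<and> snd p \<in> A} = measure \<mu> A - bdry A"
proof -
  have "measure (\<nu> \<Otimes>\<^sub>M \<mu>) ({p. fst p + snd p \<in> A \<and> snd p \<in> A} \<union> {p. fst p + snd p \<in> A \<and> snd p \<notin> A})
    = measure (\<nu> \<Otimes>\<^sub>M \<mu>) {p. fst p + snd p \<in> A \<and> snd p \<in> A} + bdry A"
    unfolding bdry_def by (intro P.finite_measure_Union walk_events A) auto
  also have "{p. fst p + snd p \<in> A \<and> snd p \<in> A} \<union> {p. fst p + snd p \<in> A \<and> snd p \<notin> A} = {p. fst p + snd p \<in> A}"
    by auto
  finally show ?thesis using measure_P(1)[OF A] by simp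
qed

text \<open>A step that enters the intersection starts outside one of the two sets and ends in both,
  so it enters that set.\<close>

lemma bdry_Int_le:
  assumes A: "A \<in> sets baire" and B: "B \<in> sets baire"
  shows "bdry (A \<inter> B) \<le> bdry A + bdry B"
proof -
  have "bdry (A \<inter> B) \<le> measure (\<nu> \<Otimes>\<^sub>M \<mu>) ({p. fst p + snd p \<in> A \<and> snd p \<notin> A} \<union> {p. fst p + snd p \<in> B \<and> snd p \<notin> B})"
    unfolding bdry_def using walk_events(2)[OF A A] walk_events(2)[OF B B]
    by (intro P.finite_measure_mono) auto
  also have "\<dots> \<le> bdry A + bdry B"
    unfolding bdry_def by (intro measure_Un_le walk_events A B)
  finally show ?thesis .
qed

lemma emeasure_walk_exit:
  assumes Y: "Y \<in> sets baire"
  shows "emeasure (\<nu> \<Otimes>\<^sub>M \<mu>) {p. fst p + snd p \<in> Y \<and> snd p \<notin> Y} = (\<integral>\<^sup>+a. emeasure \<mu> ({x. a + x \<in> Y} - Y) \<partial>\<nu>)"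
  unfolding emeasure_pair_measure_alt[OF walk_events(2)[OF Y Y]]
  by (intro nn_integral_cong arg_cong[where f="emeasure \<mu>"]) auto

text \<open>Steps act from the left and so commute with right translations, which preserve
  \<open>\<mu>\<close>.\<close>

lemma bdry_right_translate:
  assumes Y: "Y \<in> sets baire"
  shows "bdry {x. x + g \<in> Y} = bdry Y"
proof -
  have "emeasure \<mu> ({x. a + x \<in> {x. x + g \<in> Y}} - {x. x + g \<in> Y}) = emeasure \<mu> ({x. a + x \<in> Y} - Y)" for a
  proof -
    have "{x. a + x \<in> {x. x + g \<in> Y}} - {x. x + g \<in> Y} = {x. x + g \<in> {x. a + x \<in> Y} - Y}"
      by (auto simp: add.assoc)
    moreover have "{x. a + x \<in> Y} - Y \<in> sets baire"
      using left_vimage_baire[OF Y] Y by (rule sets.Diff)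
    ultimately show ?thesis by (simp only: emeasure_right)
  qed
  then show ?thesis
    by (simp only: bdry_def measure_def emeasure_walk_exit[OF right_vimage_baire[OF Y]] emeasure_walk_exit[OF Y])
qed

section \<open>Small sets of small boundary and their Rayleigh quotients\<close>

text \<open>Each intersection with an independent right translate multiplies the measures but only
  adds the boundaries.\<close>

lemma small_bdry_powers:
  assumes conn: "connected (UNIV :: 'a set)" and Y: "Y \<in> sets baire"
  shows "\<exists>Z\<in>sets baire. measure \<mu> Z = measure \<mu> Y ^ k \<and> bdry Z \<le> real k * bdry Y"
proof (induction k)
  case 0
  have "UNIV \<in> sets (baire :: 'a measure)" using sets.top[of "baire :: 'a measure"] by simp
  moreover have "bdry UNIV = 0" by (simp add: bdry_def)
  ultimately show ?case by (intro bexI[of _ UNIV]) (auto simp: prob_space[simplified])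
next
  case (Suc k)
  then obtain Z where Z: "Z \<in> sets baire" "measure \<mu> Z = measure \<mu> Y ^ k" "bdry Z \<le> real k * bdry Y" by auto
  obtain g where g: "measure \<mu> (Z \<inter> {x. x + g \<in> Y}) = measure \<mu> Z * measure \<mu> Y"
    using exists_independent_right_translate[OF conn baire_in_borel[OF Z(1)] Y] by blast
  note Yg = right_vimage_baire[OF Y, of g]
  have "bdry (Z \<inter> {x. x + g \<in> Y}) \<le> real (Suc k) * bdry Y"
    using bdry_Int_le[OF Z(1) Yg] bdry_right_translate[OF Y, of g] Z(3) by (simp add: distrib_right)
  then show ?case
    using g Z(2) sets.Int[OF Z(1) Yg] by (intro bexI[of _ "Z \<inter> {x. x + g \<in> Y}"]) auto
qed

text \<open>The test function is the centred indicator of \<open>Z\<close>. With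
  \<open>z = measure \<mu> Z\<close>, its squared norm is \<open>z - z\<^sup>2\<close>, and its
  quadratic form is the probability of staying in \<open>Z\<close>, less
  \<open>z\<^sup>2\<close>.\<close>

lemma rho_plus_indicator:
  assumes Z: "Z \<in> sets baire" and z: "0 < measure \<mu> Z" "measure \<mu> Z < 1"
  shows "measure (\<nu> \<Otimes>\<^sub>M \<mu>) {p. fst p + snd p \<in> Z \<and> snd p \<in> Z} - (measure \<mu> Z)\<^sup>2
    \<le> rho_plus \<mu> \<nu> * (measure \<mu> Z - (measure \<mu> Z)\<^sup>2)"
proof -
  define z where "z = measure \<mu> Z"
  define f :: "'a \<Rightarrow> real" where "f x = indicator Z x - z" for x
  note Z[measurable] baire_in_borel[OF Z, measurable]
  have [measurable]: "f \<in> borel_measurable baire" "f \<in> borel_measurable borel"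
    by (simp_all add: f_def[abs_def])
  have int: "integrable \<mu> (indicator Z :: 'a \<Rightarrow> real)" by (simp add: emeasure_eq_measure)
  have sq: "(f x)\<^sup>2 = (1 - 2 * z) * indicator Z x + z\<^sup>2" for x
    by (auto simp: f_def indicator_def power2_eq_square algebra_simps)
  have f2: "integrable \<mu> (\<lambda>x. (f x)\<^sup>2)" unfolding sq using int by simp
  have norm: "(\<integral>x. (f x)\<^sup>2 \<partial>\<mu>) = z - z\<^sup>2"
    unfolding sq using int by (simp add: z_def prob_space[simplified] power2_eq_square algebra_simps)
  have pos: "0 < z - z\<^sup>2" using assms by (simp add: z_def power2_eq_square)
  have "(\<integral>x. f x \<partial>\<mu>) = 0"
    using int by (simp add: f_def z_def prob_space[simplified])
  then have "f \<in> L2_0 \<mu>" using f2 by (simp add: L2_0_def L2_def)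
  moreover have "\<not> (AE x in \<mu>. f x = 0)"
  proof
    assume "AE x in \<mu>. f x = 0"
    then have "(\<integral>x. (f x)\<^sup>2 \<partial>\<mu>) = (\<integral>x. 0 \<partial>\<mu>)" by (intro integral_cong_AE) auto
    with norm pos show False by simp
  qed
  ultimately have le: "L2_inner \<mu> (averaging \<nu> f) f / L2_inner \<mu> f f \<le> rho_plus \<mu> \<nu>"
    by (rule rho_plus_upper)
  have eqs: "L2_inner \<mu> f f = (\<integral>x. (f x)\<^sup>2 \<partial>\<mu>)"
    "L2_inner \<mu> (averaging \<nu> f) f = (\<integral>p. f (fst p + snd p) * f (snd p) \<partial>(\<nu> \<Otimes>\<^sub>M \<mu>))"
    using L2_inner_averaging[of f f "{}"] f2 by auto
  define A where "A = {p. fst p + snd p \<in> Z}"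
  define B where "B = {p :: 'a \<times> 'a. snd p \<in> Z}"
  have AB: "A \<inter> B = {p. fst p + snd p \<in> Z \<and> snd p \<in> Z}" by (auto simp: A_def B_def)
  have meas: "A \<in> sets (\<nu> \<Otimes>\<^sub>M \<mu>)" "B \<in> sets (\<nu> \<Otimes>\<^sub>M \<mu>)" "A \<inter> B \<in> sets (\<nu> \<Otimes>\<^sub>M \<mu>)"
    unfolding AB using walk_events[OF Z Z] by (simp_all add: A_def B_def)
  have ints: "integrable (\<nu> \<Otimes>\<^sub>M \<mu>) (indicator A :: _ \<Rightarrow> real)" "integrable (\<nu> \<Otimes>\<^sub>M \<mu>) (indicator B :: _ \<Rightarrow> real)"
    "integrable (\<nu> \<Otimes>\<^sub>M \<mu>) (indicator (A \<inter> B) :: _ \<Rightarrow> real)"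
    using meas by (simp_all add: P.emeasure_eq_measure)
  have "(\<integral>p. f (fst p + snd p) * f (snd p) \<partial>(\<nu> \<Otimes>\<^sub>M \<mu>))
    = (\<integral>p. indicator (A \<inter> B) p - z * indicator A p - z * indicator B p + z\<^sup>2 \<partial>(\<nu> \<Otimes>\<^sub>M \<mu>))"
    by (intro Bochner_Integration.integral_cong)
       (auto simp: f_def A_def B_def indicator_def power2_eq_square algebra_simps)
  also have "\<dots> = measure (\<nu> \<Otimes>\<^sub>M \<mu>) (A \<inter> B) - z * measure (\<nu> \<Otimes>\<^sub>M \<mu>) A - z * measure (\<nu> \<Otimes>\<^sub>M \<mu>) B + z\<^sup>2"
    using ints meas by (simp add: P.prob_space[simplified])
  also have "\<dots> = measure (\<nu> \<Otimes>\<^sub>M \<mu>) (A \<inter> B) - z\<^sup>2"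
    using measure_P[OF Z] by (simp add: A_def B_def z_def power2_eq_square)
  finally show ?thesis
    using le pos unfolding eqs norm AB by (simp add: z_def pos_divide_le_eq)
qed

section \<open>From almost invariant functions to sets of small boundary\<close>

text \<open>If all Baire sets of measure at most 1/2 had boundary at least \<open>s\<close> times
  their measure, the level-set inequality for \<open>f'\<close> minus its median would force the
  Rayleigh quotient down to \<open>1 - s\<^sup>2 / 2\<close>.\<close>

lemma small_bdry_set:
  assumes f: "f \<in> L2_0 \<mu>" "\<not> (AE x in \<mu>. f x = 0)"
    and ratio: "1 - s\<^sup>2 / 2 < L2_inner \<mu> (averaging \<nu> f) f / L2_inner \<mu> f f" and s: "0 \<le> s"
  obtains Y where "Y \<in> sets baire" "0 < measure \<mu> Y" "measure \<mu> Y \<le> 1/2" "bdry Y < s * measure \<mu> Y"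
proof -
  have "\<exists>Y\<in>sets baire. measure \<mu> Y \<le> 1/2 \<and> bdry Y < s * measure \<mu> Y"
  proof (rule ccontr)
    assume "\<not> ?thesis"
    then have large: "s * measure \<mu> Y \<le> bdry Y" if "Y \<in> sets baire" "measure \<mu> Y \<le> 1/2" for Y
      using that by (meson not_le)
    have fb: "f \<in> borel_measurable borel" "integrable \<mu> (\<lambda>x. (f x)\<^sup>2)" "(\<integral>x. f x \<partial>\<mu>) = 0"
      using f(1) by (auto simp: L2_0_def L2_def)
    obtain f' N where f': "f' \<in> borel_measurable baire" "N \<in> sets baire" "emeasure \<mu> N = 0" "\<And>x. x \<notin> N \<Longrightarrow> f x = f' x"
      using baire_version[OF fb(1)] by blast
    note eqs = L2_inner_averaging[OF fb(1,2) f']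
    note shift = integrable_shift_mult[OF f'(1) eqs(1)]
    note f'(1)[measurable]
    have f'_borel [measurable]: "f' \<in> borel_measurable borel"
      using measurable_compose[OF measurable_id_baire f'(1)] .
    define n2 where "n2 = (\<integral>x. (f' x)\<^sup>2 \<partial>\<mu>)"
    have "n2 \<noteq> 0"
    proof
      assume "n2 = 0"
      then have "AE x in \<mu>. (f' x)\<^sup>2 = 0"
        using integral_nonneg_eq_0_iff_AE[OF eqs(1)] by (simp add: n2_def)
      moreover have "AE x in \<mu>. x \<notin> N"
        using f'(2,3) baire_in_borel[OF f'(2)] by (intro AE_not_in) (simp add: null_sets_def)
      ultimately have "AE x in \<mu>. f x = 0"
        by eventually_elim (use f'(4) in auto)
      with f(2) show False by simp
    qed
    moreover have "0 \<le> n2" by (simp add: n2_def)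
    ultimately have n2: "0 < n2" by simp
    have int_f': "integrable \<mu> f'"
    proof (rule Bochner_Integration.integrable_bound[of _ "\<lambda>x. 1 + (f' x)\<^sup>2"])
      show "AE x in \<mu>. norm (f' x) \<le> norm (1 + (f' x)\<^sup>2)"
      proof (rule AE_I2)
        fix x
        have "0 \<le> (\<bar>f' x\<bar> - 1/2)\<^sup>2" by simp
        then show "norm (f' x) \<le> norm (1 + (f' x)\<^sup>2)" by (simp add: power2_diff power_divide)
      qed
    qed (use eqs(1) in auto)
    obtain m where m: "measure \<mu> {x. m < f' x} \<le> 1/2" "measure \<mu> {x. f' x < m} \<le> 1/2"
    proof (rule median_exists)
      show "f' \<in> borel_measurable \<mu>" by measurable
      fix m assume "measure \<mu> {x \<in> space \<mu>. m < f' x} \<le> 1/2" "measure \<mu> {x \<in> space \<mu>. f' x < m} \<le> 1/2"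
      then show thesis by (intro that[of m]) simp_all
    qed
    \<comment> \<open>Beyond the median, upper and lower level sets have measure at most 1/2, so
      \<open>large\<close> applies to them.\<close>
    define F H where "F p = f' (fst p + snd p) - m" and "H p = f' (snd p) - m" for p
    have FH [measurable]: "F \<in> borel_measurable (\<nu> \<Otimes>\<^sub>M \<mu>)" "H \<in> borel_measurable (\<nu> \<Otimes>\<^sub>M \<mu>)"
      by (simp_all add: F_def[abs_def] H_def[abs_def])
    have [measurable]: "(\<lambda>x. f' x - m) \<in> borel_measurable baire" by measurable
    have H_sq: "(H p)\<^sup>2 = (f' (snd p))\<^sup>2 - 2 * m * f' (snd p) + m\<^sup>2" for p
      by (simp add: H_def power2_diff)
    have int_H: "integrable (\<nu> \<Otimes>\<^sub>M \<mu>) (\<lambda>p. f' (snd p))" "(\<integral>p. f' (snd p) \<partial>(\<nu> \<Otimes>\<^sub>M \<mu>)) = 0"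
      using integral_plus(3,4)[OF f'(1)] int_f' eqs(2) fb(3) by simp_all
    have H2: "integrable (\<nu> \<Otimes>\<^sub>M \<mu>) (\<lambda>p. (H p)\<^sup>2)"
      unfolding H_sq using shift(3) int_H by simp
    \<comment> \<open>The cross term vanishes because \<open>f'\<close> has integral 0, so the shift
      by \<open>m\<close> does not decrease the norm.\<close>
    have norm_H: "(\<integral>p. (H p)\<^sup>2 \<partial>(\<nu> \<Otimes>\<^sub>M \<mu>)) = n2 + m\<^sup>2"
      unfolding H_sq using shift(3,5) int_H by (simp add: n2_def P.prob_space[simplified])
    have "s\<^sup>2 * (\<integral>p. (H p)\<^sup>2 \<partial>(\<nu> \<Otimes>\<^sub>M \<mu>)) \<le> (\<integral>p. (F p - H p)\<^sup>2 \<partial>(\<nu> \<Otimes>\<^sub>M \<mu>))"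
    proof (rule P.L2_gap_of_level_sets[OF FH _ H2 s])
      have 1: "distr (\<nu> \<Otimes>\<^sub>M \<mu>) borel F = distr (distr (\<nu> \<Otimes>\<^sub>M \<mu>) baire (\<lambda>p. fst p + snd p)) borel (\<lambda>x. f' x - m)"
        by (subst distr_distr) (simp_all add: F_def[abs_def] comp_def)
      have 2: "distr (\<nu> \<Otimes>\<^sub>M \<mu>) borel H = distr (distr (\<nu> \<Otimes>\<^sub>M \<mu>) baire snd) borel (\<lambda>x. f' x - m)"
        by (subst distr_distr) (simp_all add: H_def[abs_def] comp_def)
      show "distr (\<nu> \<Otimes>\<^sub>M \<mu>) borel F = distr (\<nu> \<Otimes>\<^sub>M \<mu>) borel H"
        unfolding 1 2 distr_plus distr_snd ..
    next
      fix t :: real assume t: "0 \<le> t"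
      define Y where "Y = {x. t < f' x - m}"
      have Y: "Y \<in> sets baire"
      proof -
        have "{x \<in> space baire. t < f' x - m} \<in> sets baire" by measurable
        then show ?thesis by (simp add: Y_def)
      qed
      have "measure \<mu> Y \<le> measure \<mu> {x. m < f' x}"
        using t by (intro finite_measure_mono) (auto simp: Y_def)
      with m(1) large[OF Y] have "s * measure \<mu> Y \<le> bdry Y" by simp
      moreover have "measure \<mu> Y = measure (\<nu> \<Otimes>\<^sub>M \<mu>) {p. t < H p}"
        using measure_P(2)[OF Y] by (simp add: Y_def H_def)
      ultimately show "s * measure (\<nu> \<Otimes>\<^sub>M \<mu>) {p \<in> space (\<nu> \<Otimes>\<^sub>M \<mu>). t < H p} \<le> measure (\<nu> \<Otimes>\<^sub>M \<mu>) {p \<in> space (\<nu> \<Otimes>\<^sub>M \<mu>). t < F p \<and> H p \<le> t}"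
        by (simp add: bdry_def Y_def F_def H_def not_less)
    next
      fix t :: real assume t: "0 \<le> t"
      define Y where "Y = {x. f' x - m < - t}"
      have Y: "Y \<in> sets baire"
      proof -
        have "{x \<in> space baire. f' x - m < - t} \<in> sets baire" by measurable
        then show ?thesis by (simp add: Y_def)
      qed
      have "measure \<mu> Y \<le> measure \<mu> {x. f' x < m}"
        using t by (intro finite_measure_mono) (auto simp: Y_def)
      with m(2) large[OF Y] have "s * measure \<mu> Y \<le> bdry Y" by simp
      moreover have "measure \<mu> Y = measure (\<nu> \<Otimes>\<^sub>M \<mu>) {p. H p < - t}"
        using measure_P(2)[OF Y] by (simp add: Y_def H_def)
      ultimately show "s * measure (\<nu> \<Otimes>\<^sub>M \<mu>) {p \<in> space (\<nu> \<Otimes>\<^sub>M \<mu>). H p < - t} \<le> measure (\<nu> \<Otimes>\<^sub>M \<mu>) {p \<in> space (\<nu> \<Otimes>\<^sub>M \<mu>). F p < - t \<and> - t \<le> H p}"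
        by (simp add: bdry_def Y_def F_def H_def not_less)
    qed
    \<comment> \<open>The median cancels in the difference, and equidistribution leaves the
      quadratic form of the averaging operator.\<close>
    also have "(\<integral>p. (F p - H p)\<^sup>2 \<partial>(\<nu> \<Otimes>\<^sub>M \<mu>))
      = (\<integral>p. (f' (fst p + snd p))\<^sup>2 + (f' (snd p))\<^sup>2 - 2 * (f' (fst p + snd p) * f' (snd p)) \<partial>(\<nu> \<Otimes>\<^sub>M \<mu>))"
      by (intro Bochner_Integration.integral_cong) (auto simp: F_def H_def power2_diff)
    also have "\<dots> = 2 * n2 - 2 * L2_inner \<mu> (averaging \<nu> f) f"
      using shift by (simp add: n2_def eqs)
    finally have "s\<^sup>2 * (n2 + m\<^sup>2) \<le> 2 * n2 - 2 * L2_inner \<mu> (averaging \<nu> f) f"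
      by (simp only: norm_H)
    moreover have "(1 - s\<^sup>2 / 2) * n2 < L2_inner \<mu> (averaging \<nu> f) f"
      using ratio n2 eqs(3) by (simp add: n2_def pos_less_divide_eq)
    moreover have "0 \<le> s\<^sup>2 * m\<^sup>2" by simp
    ultimately show False by (simp only: algebra_simps)
  qed
  then obtain Y where Y: "Y \<in> sets baire" "measure \<mu> Y \<le> 1/2" "bdry Y < s * measure \<mu> Y" by auto
  moreover have "0 \<le> bdry Y" by (simp add: bdry_def)
  \<comment> \<open>A boundary is nonnegative, so the strict inequality excludes null sets.\<close>
  ultimately have "measure \<mu> Y \<noteq> 0" by auto
  then show ?thesis using Y that[of Y] by (simp add: less_le)
qed

section \<open>Ergodicity in terms of boundaries\<close>

text \<open>Reconciles \<open>bdry\<close>, which involves preimages of \<open>Y\<close> under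
  translation, with \<open>ergodic\<close>, which involves images. As \<open>T\<close> and
  \<open>Y\<close> have equal measure, so do \<open>T - Y\<close> and \<open>Y - T\<close>, and
  translation by \<open>a\<close> carries the latter to the image form.\<close>

lemma emeasure_left_translate_Diff:
  assumes Y [measurable]: "Y \<in> sets borel"
  shows "emeasure \<mu> ({x. a + x \<in> Y} - Y) = emeasure \<mu> ((+) a ` Y - Y)"
proof -
  define T where "T = {x. a + x \<in> Y}"
  have [measurable]: "T \<in> sets borel" unfolding T_def by (rule left_vimage_borel[OF Y])
  have mT: "measure \<mu> T = measure \<mu> Y" by (simp add: T_def measure_def emeasure_left Y)
  have "(+) a ` Y - Y = {x. - a + x \<in> Y - T}"
    by (auto simp: image_left T_def add.assoc[symmetric])
  then have "emeasure \<mu> ((+) a ` Y - Y) = emeasure \<mu> (Y - T)"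
    using emeasure_left[of "Y - T" "- a"] by simp
  also have "\<dots> = emeasure \<mu> (T - Y)"
    using mT finite_measure_Diff'[of Y T] finite_measure_Diff'[of T Y]
    by (simp add: emeasure_eq_measure Int_commute)
  finally show ?thesis by (simp add: T_def)
qed

text \<open>Start and end of a step lie in \<open>Y\<close> with equal probability, so entering and
  leaving \<open>Y\<close> are equally likely.\<close>

lemma bdry_Compl:
  assumes Y: "Y \<in> sets baire"
  shows "bdry (- Y) = bdry Y"
proof -
  have "measure (\<nu> \<Otimes>\<^sub>M \<mu>) ({p. snd p \<in> Y} - {p. fst p + snd p \<in> Y \<and> snd p \<in> Y})
      = measure \<mu> Y - (measure \<mu> Y - bdry Y)"
    using measure_P(2)[OF Y] measure_P_stay[OF Y] walk_events[OF Y Y]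
    by (subst P.finite_measure_Diff) auto
  also have "{p. snd p \<in> Y} - {p. fst p + snd p \<in> Y \<and> snd p \<in> Y} = {p. fst p + snd p \<in> - Y \<and> snd p \<notin> - Y}"
    by auto
  finally show ?thesis by (simp add: bdry_def)
qed

text \<open>An invariant Borel set is replaced by a Baire set that differs from it inside a null
  Baire set; translates of that null set are null, so the boundary is still 0. Of the Baire set and
  its complement, one has measure at most 1/2.\<close>

lemma ergodicI:
  assumes bdry: "\<And>Y. Y \<in> sets baire \<Longrightarrow> 0 < measure \<mu> Y \<Longrightarrow> measure \<mu> Y \<le> 1/2 \<Longrightarrow> bdry Y \<noteq> 0"
  shows "ergodic \<mu> \<nu>"
  unfolding ergodic_def
proof (intro ballI impI)
  fix Y0 :: "'a set" assume Y0 [measurable]: "Y0 \<in> sets borel"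
    and zero: "(\<integral>\<^sup>+a. emeasure \<mu> ((+) a ` Y0 - Y0) \<partial>\<nu>) = 0"
  have "(indicator Y0 :: 'a \<Rightarrow> real) \<in> borel_measurable borel" by measurable
  then obtain f' :: "'a \<Rightarrow> real" and N where f' [measurable]: "f' \<in> borel_measurable baire"
    and N: "N \<in> sets baire" "emeasure \<mu> N = 0" "\<And>x. x \<notin> N \<Longrightarrow> indicator Y0 x = f' x"
    by (rule baire_version) blast
  \<comment> \<open>Off \<open>N\<close> the function \<open>f'\<close> is an indicator, and 1/2
    separates its two values.\<close>
  define Y where "Y = {x. 1/2 < f' x}"
  have Y: "Y \<in> sets baire"
  proof -
    have "{x \<in> space baire. 1/2 < f' x} \<in> sets baire" by measurable
    then show ?thesis by (simp add: Y_def)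
  qed
  note YB = baire_in_borel[OF Y]
  have iff: "x \<in> Y \<longleftrightarrow> x \<in> Y0" if "x \<notin> N" for x
    using N(3)[OF that] by (cases "x \<in> Y0") (auto simp: Y_def)
  have AE1: "AE x in \<mu>. x \<notin> N"
    using N(1,2) baire_in_borel[OF N(1)] by (intro AE_not_in) (simp add: null_sets_def)
  have AE2: "AE x in \<mu>. a + x \<notin> N" for a
  proof -
    have "{x. a + x \<in> N} \<in> null_sets \<mu>"
      using N(1,2) baire_in_borel[OF left_vimage_baire[OF N(1)]] by (simp add: null_sets_def emeasure_left_baire)
    then show ?thesis using AE_not_in[of "{x. a + x \<in> N}" \<mu>] by simp
  qed
  have "emeasure \<mu> ({x. a + x \<in> Y} - Y) = emeasure \<mu> ((+) a ` Y0 - Y0)" for a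
  proof -
    have "emeasure \<mu> ({x. a + x \<in> Y} - Y) = emeasure \<mu> ({x. a + x \<in> Y0} - Y0)"
    proof (rule emeasure_eq_AE)
      show "AE x in \<mu>. x \<in> {x. a + x \<in> Y} - Y \<longleftrightarrow> x \<in> {x. a + x \<in> Y0} - Y0"
        using AE1 AE2[of a] by eventually_elim (simp add: iff)
    qed (use left_vimage_borel[OF YB] left_vimage_borel[OF Y0] YB Y0 in auto)
    then show ?thesis by (simp only: emeasure_left_translate_Diff[OF Y0])
  qed
  then have "bdry Y = 0"
    using zero by (simp only: bdry_def measure_def emeasure_walk_exit[OF Y]) simp
  have "measure \<mu> Y = measure \<mu> Y0"
    unfolding measure_def
    by (intro arg_cong[where f=enn2real] emeasure_eq_AE) (use AE1 iff YB Y0 in \<open>auto elim!: eventually_mono\<close>)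
  moreover have "measure \<mu> Y \<in> {0, 1}"
  proof (rule ccontr)
    assume not: "measure \<mu> Y \<notin> {0, 1}"
    have "- Y \<in> sets baire" using sets.compl_sets[OF Y] by (simp add: Compl_eq_Diff_UNIV)
    moreover have "measure \<mu> (- Y) = 1 - measure \<mu> Y"
      using prob_compl[of Y] YB by (simp add: Compl_eq_Diff_UNIV)
    moreover have "0 < measure \<mu> Y" "measure \<mu> Y < 1"
      using not prob_le_1[of Y] by (auto simp: less_le)
    ultimately show False
      using bdry[OF Y] bdry[of "- Y"] \<open>bdry Y = 0\<close> bdry_Compl[OF Y]
      by (cases "measure \<mu> Y \<le> 1/2") auto
  qed
  ultimately show "measure \<mu> Y0 \<in> {0, 1}" by simp
qed

end

section \<open>Choice of constants and conclusion\<close>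

text \<open>With boundary at most \<open>z / 4\<close>, a step of \<open>\<nu>1\<close> stays in
  \<open>Z\<close> with probability at least \<open>3 * z / 4\<close>, hence a step of
  \<open>\<nu>\<close> with probability at least \<open>3 / 2 * \<rho> * z\<close>. For
  \<open>z \<le> \<rho> / 2\<close> this exceeds what \<open>rho_plus_indicator\<close>
  permits.\<close>

lemma no_small_bdry_set:
  fixes \<mu> \<nu> \<nu>1 :: "'a::{topological_group_add, t2_space} measure"
  assumes W: "compact_haar_walk \<mu> \<nu>" and W1: "compact_haar_walk \<mu> \<nu>1"
    and conn: "connected (UNIV :: 'a set)"
    and \<rho>: "\<rho> = rho_plus \<mu> \<nu>" "0 < \<rho>" "2 * \<rho> \<le> \<kappa>" "\<kappa> \<le> 1"
    and dom: "\<And>A. A \<in> sets borel \<Longrightarrow> \<kappa> * measure \<nu>1 A \<le> measure \<nu> A"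
    and Y: "Y \<in> sets baire" "0 < measure \<mu> Y" "measure \<mu> Y \<le> 1/2"
  shows "\<rho> / (15 * log 2 (2 / \<rho>)) * measure \<mu> Y < compact_haar_walk.bdry \<mu> \<nu>1 Y"
proof (rule ccontr)
  interpret W: compact_haar_walk \<mu> \<nu> by fact
  interpret W1: compact_haar_walk \<mu> \<nu>1 by fact
  define L where "L = log 2 (2 / \<rho>)"
  define y where "y = measure \<mu> Y"
  assume "\<not> ?thesis"
  then have bY: "W1.bdry Y \<le> \<rho> / (15 * L) * y" by (simp add: L_def y_def)
  have y: "0 < y" "y \<le> 1/2" using Y by (simp_all add: y_def)
  have \<rho>_le: "\<rho> \<le> 1/2" using \<rho> by simp
  have "2 \<le> L"
  proof -
    have "(2::real) powr 2 \<le> 2 / \<rho>" using \<rho>(2) \<rho>_le by (simp add: field_simps)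
    then show ?thesis using \<rho>(2) by (simp add: L_def le_log_iff)
  qed
  obtain n where "y ^ n < \<rho> / 2" using real_arch_pow_inv[of "\<rho> / 2" y] \<rho>(2) y by auto
  then have ex: "\<exists>k. y ^ k \<le> \<rho> / 2" by (intro exI[of _ n]) simp
  define k where "k = (LEAST k. y ^ k \<le> \<rho> / 2)"
  have k: "y ^ k \<le> \<rho> / 2" unfolding k_def by (rule LeastI_ex[OF ex])
  have "k \<noteq> 0"
  proof
    assume "k = 0"
    then show False using k \<rho>_le by simp
  qed
  then obtain j where j: "k = Suc j" by (cases k) auto
  \<comment> \<open>Minimality of \<open>k\<close> keeps \<open>z = y ^ j * y\<close> above
    \<open>\<rho> / 2 * y\<close>, which is what makes the boundary estimate relative to
    \<open>z\<close>.\<close>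
  have yj: "\<rho> / 2 < y ^ j"
    using not_less_Least[of j "\<lambda>k. y ^ k \<le> \<rho> / 2"] j by (simp add: k_def not_le)
  have "y ^ j \<le> (1/2) ^ j" using y by (intro power_mono) auto
  with yj have "\<rho> / 2 < 1 / 2 ^ j" by (simp add: power_one_over)
  then have "2 ^ j < 2 / \<rho>" using \<rho>(2) by (simp add: field_simps)
  then have "real j < L" unfolding L_def by (intro less_log_of_power) auto
  \<comment> \<open>Here \<open>k = j + 1 < L + 1\<close>, and \<open>2 \<le> L\<close> absorbs the
    additional 1.\<close>
  then have kL: "8 * real k \<le> 15 * L" using \<open>2 \<le> L\<close> j by simp
  obtain Z where Z: "Z \<in> sets baire" "measure \<mu> Z = y ^ k" "W1.bdry Z \<le> real k * W1.bdry Y"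
    using W1.small_bdry_powers[OF conn Y(1), of k] by (auto simp: y_def)
  define z where "z = measure \<mu> Z"
  have z: "0 < z" "z \<le> \<rho> / 2" using Z(2) k y by (simp_all add: z_def)
  have "W1.bdry Z \<le> z / 4"
  proof -
    have "W1.bdry Z \<le> real k * (\<rho> / (15 * L) * y)"
      using Z(3) mult_left_mono[OF bY, of "real k"] by simp
    also have "\<dots> = (8 * real k / (15 * L)) * (\<rho> / 2 * y / 4)"
      using \<open>2 \<le> L\<close> by (simp add: field_simps)
    also have "\<dots> \<le> 1 * (\<rho> / 2 * y / 4)"
      using kL \<open>2 \<le> L\<close> \<rho>(2) y(1) by (intro mult_right_mono) auto
    also have "\<dots> \<le> y ^ j * y / 4"
      using mult_right_mono[OF less_imp_le[OF yj], of y] y(1) by simp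
    also have "\<dots> = z / 4" using Z(2) j by (simp add: z_def mult.commute)
    finally show ?thesis .
  qed
  define E where "E = {p. fst p + snd p \<in> Z \<and> snd p \<in> Z}"
  have E: "E \<in> sets (borel \<Otimes>\<^sub>M \<mu>)"
    unfolding E_def using W.walk_events(1)[OF Z(1) Z(1)] sets_pair_measure_cong[OF W.sets_\<nu> refl, of \<mu>] by simp
  have "\<kappa> * measure (\<nu>1 \<Otimes>\<^sub>M \<mu>) E \<le> measure (\<nu> \<Otimes>\<^sub>M \<mu>) E"
    by (rule pair_measure_dominated[OF _ _ _ W.sets_\<nu> W1.sets_\<nu> _ dom E])
       (use \<rho> W.prob_space_axioms W.\<nu>.prob_space_axioms W1.\<nu>.prob_space_axioms in auto)
  then have stay: "\<kappa> * (z - W1.bdry Z) \<le> measure (\<nu> \<Otimes>\<^sub>M \<mu>) E"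
    using W1.measure_P_stay[OF Z(1)] by (simp add: E_def z_def)
  have test: "measure (\<nu> \<Otimes>\<^sub>M \<mu>) E - z\<^sup>2 \<le> \<rho> * (z - z\<^sup>2)"
    using W.rho_plus_indicator[OF Z(1)] z \<rho>_le unfolding E_def z_def \<rho>(1)[symmetric] by simp
  have "2 * \<rho> * (z - z / 4) \<le> \<kappa> * (z - W1.bdry Z)"
    using \<rho>(2,3) z(1) \<open>W1.bdry Z \<le> z / 4\<close> by (intro mult_mono) auto
  then have "2 * \<rho> * (z - z / 4) - z\<^sup>2 \<le> \<rho> * (z - z\<^sup>2)" using stay test by linarith
  moreover have "z * z \<le> z * (\<rho> / 2)" using z by (intro mult_left_mono) auto
  \<comment> \<open>The other terms balance exactly when \<open>z = \<rho> / 2\<close>; this one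
    makes the contradiction strict.\<close>
  moreover have "0 < \<rho> * z\<^sup>2" using \<rho>(2) z(1) by simp
  ultimately show False by (simp add: algebra_simps power2_eq_square)
qed

theorem corollary3:
  fixes \<mu> \<nu> \<nu>1 \<nu>2 :: "'a::{topological_group_add, t2_space} measure"
    and \<kappa> :: real
  assumes "compact (UNIV :: 'a set)" and "connected (UNIV :: 'a set)"
    and "normalized_haar \<mu>"
    and "borel_prob \<nu>" and "borel_prob \<nu>1" and "borel_prob \<nu>2"
    and "\<kappa> \<le> 1" and "\<kappa> \<ge> 2 * rho_plus \<mu> \<nu>" and "rho_plus \<mu> \<nu> > 0"
    and "\<And>A. A \<in> sets borel \<Longrightarrow>
           measure \<nu> A = \<kappa> * measure \<nu>1 A + (1 - \<kappa>) * measure \<nu>2 A"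
  shows "ergodic \<mu> \<nu>1 \<and>
         rho_plus \<mu> \<nu>1 < 1 - 1 / 512 * (rho_plus \<mu> \<nu> / log 2 (2 / rho_plus \<mu> \<nu>))\<^sup>2"
proof -
  interpret W: compact_haar_walk \<mu> \<nu> using assms by unfold_locales
  interpret W1: compact_haar_walk \<mu> \<nu>1 using assms by unfold_locales
  define \<rho> where "\<rho> = rho_plus \<mu> \<nu>"
  define L where "L = log 2 (2 / \<rho>)"
  have \<rho>: "0 < \<rho>" "2 * \<rho> \<le> \<kappa>" "\<rho> \<le> 1/2" using assms(7-9) by (simp_all add: \<rho>_def)
  have "2 / \<rho> \<ge> 2" using \<rho> by (simp add: field_simps)
  then have L: "1 \<le> L" unfolding L_def using \<rho> by (simp add: le_log_iff)
  have dom: "\<kappa> * measure \<nu>1 A \<le> measure \<nu> A" if "A \<in> sets borel" for A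
    using assms(7) assms(10)[OF that] by simp
  have large: "\<rho> / (15 * L) * measure \<mu> Y < W1.bdry Y"
    if "Y \<in> sets baire" "0 < measure \<mu> Y" "measure \<mu> Y \<le> 1/2" for Y
    unfolding L_def
    by (rule no_small_bdry_set[OF W.compact_haar_walk_axioms W1.compact_haar_walk_axioms assms(2) \<rho>_def \<rho>(1,2) assms(7) dom that])
  have erg: "ergodic \<mu> \<nu>1"
  proof (rule W1.ergodicI)
    fix Y :: "'a set" assume "Y \<in> sets baire" "0 < measure \<mu> Y" "measure \<mu> Y \<le> 1/2"
    moreover from this have "0 < \<rho> / (15 * L) * measure \<mu> Y" using \<rho> L by simp
    ultimately show "W1.bdry Y \<noteq> 0" using large[of Y] by simp
  qed
  \<comment> \<open>The theorem's constant 512 is \<open>2 * 16\<^sup>2\<close>. Using 15 gives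
    \<open>s\<^sup>2 / 2\<close> the denominator 450, so the negated bound yields the strict
    inequality that \<open>small_bdry_set\<close> requires.\<close>
  define s where "s = \<rho> / (15 * L)"
  have s: "0 < s" using \<rho> L by (simp add: s_def)
  have s_eq: "s\<^sup>2 / 2 = (\<rho> / L)\<^sup>2 / 450" by (simp add: s_def power_divide power_mult_distrib)
  have "\<rho> / L \<le> 1" using \<rho> L by (simp add: divide_le_eq)
  then have rL: "(\<rho> / L)\<^sup>2 \<le> 1" "0 < (\<rho> / L)\<^sup>2" using \<rho> L by (simp_all add: power_le_one)
  have "rho_plus \<mu> \<nu>1 < 1 - 1 / 512 * (\<rho> / L)\<^sup>2"
  proof (rule ccontr)
    assume "\<not> ?thesis"
    then have less: "1 - s\<^sup>2 / 2 < rho_plus \<mu> \<nu>1" using rL(2) unfolding s_eq by linarith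
    have nonempty: "{f \<in> L2_0 \<mu>. \<not> (AE x in \<mu>. f x = 0)} \<noteq> {}"
    proof
      \<comment> \<open>For the trivial group both suprema are the same unspecified real \<open>Sup {}\<close>.\<close>
      assume "{f \<in> L2_0 \<mu>. \<not> (AE x in \<mu>. f x = 0)} = {}"
      then have "rho_plus \<mu> \<nu>1 = \<rho>" by (simp only: rho_plus_def \<rho>_def image_empty)
      with less s_eq rL \<rho>(3) show False by linarith
    qed
    obtain f where f: "f \<in> L2_0 \<mu>" "\<not> (AE x in \<mu>. f x = 0)"
      "1 - s\<^sup>2 / 2 < L2_inner \<mu> (averaging \<nu>1 f) f / L2_inner \<mu> f f"
      using less nonempty unfolding rho_plus_def by (elim less_cSupE) auto
    obtain Y where "Y \<in> sets baire" "0 < measure \<mu> Y" "measure \<mu> Y \<le> 1/2" "W1.bdry Y < s * measure \<mu> Y"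
      using W1.small_bdry_set[OF f less_imp_le[OF s]] .
    then show False using large[of Y] by (simp add: s_def)
  qed
  with erg show ?thesis by (simp add: \<rho>_def L_def)
qed

end
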